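(* Let $\mathcal{K}$, $\mathcal{H}$, $\mathcal{G}$ be groupoids, let $\mathcal{M}$ be a subgroupoid of $\mathcal{K}\times\mathcal{H}$ with $\mathcal{M}_0=\mathcal{K}_0\times\mathcal{H}_0$, and let $\mathcal{L}$ be a subgroupoid of $\mathcal{H}\times\mathcal{G}$ with $\mathcal{L}_0=\mathcal{H}_0\times\mathcal{G}_0$. Let $$X=\{(w,u,h,v,a)\in\mathcal{K}_0\times\mathcal{H}_0\times\mathcal{H}_1\times\mathcal{H}_0\times\mathcal{G}_0 \mid (w,u)\in\mathcal{M}_0,\ (v,a)\in\mathcal{L}_0,\ u=\mathsf{t}(h),\ v=\mathsf{s}(h)\}$$ with its $(\mathcal{M},\mathcal{L})$-biset structure described in the context, and let $\mathrm{rep}_{(\mathcal{M},\mathcal{L})}(X)$ be a set of representatives of the orbits of $X$ as an $(\mathcal{M},\mathcal{L})$-biset. Then there is a (non canonical) isomorphism of $(\mathcal{K},\mathcal{G})$-bisets $$\left(\frac{\mathcal{K}\times\mathcal{H}}{\mathcal{M}}\right)^{\mathsf{L}}\otimes_{\mathcal{H}}\left(\frac{\mathcal{H}\times\mathcal{G}}{\mathcal{L}}\right)^{\mathsf{L}}\;\cong\;\biguplus_{(w,u,h,v,a)\,\in\,\mathrm{rep}_{(\mathcal{M},\mathcal{L})}(X)}\left(\frac{\mathcal{K}\times\mathcal{G}}{\mathcal{M}^{(w,u)}\ast\left({}^{(h,\iota_a)}\mathcal{L}^{(v,a)}\right)}\right)^{\mathsf{L}},$$ where the right-hand side is the coproduct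 (disjoint union) in the category of $(\mathcal{K},\mathcal{G})$-bisets.
   Context: Groupoids. A groupoid $\mathcal{G}=(\mathcal{G}_1,\mathcal{G}_0)$ is a small category in which every arrow is invertible, with objects $\mathcal{G}_0$, arrows $\mathcal{G}_1$, source $\mathsf{s}$, target $\mathsf{t}$, identity arrows $\iota_x$; the product $gg'$ is defined iff $\mathsf{s}(g)=\mathsf{t}(g')$. The isotropy group at $x$ is $\mathcal{G}^{x}=\{g\in\mathcal{G}_1\mid \mathsf{s}(g)=\mathsf{t}(g)=x\}$; it is also regarded as a subgroupoid with the single object $x$. The product groupoid $\mathcal{K}\times\mathcal{H}$ has objects $\mathcal{K}_0\times\mathcal{H}_0$, arrows $\mathcal{K}_1\times\mathcal{H}_1$ and componentwise structure. A subgroupoid is a subcategory closed under inverses. Groupoid-sets. A right $\mathcal{G}$-set is a set $X$ with a map $\varsigma:X\to\mathcal{G}_0$ and an action $(x,g)\mapsto xg\in X$ defined when $\varsigma(x)=\mathsf{t}(g)$, such that $\varsigma(xg)=\mathsf{s}(g)$, $x\iota_{\varsigma(x)}=x$, $(xg)g'=x(gg')$. A left $\mathcal{H}$-set is a set $X$ with a map $\vartheta:X\to\mathcal{H}_0$ and an action $(h,x)\mapsto hx$ defined when $\mathsf{s}(h)=\vartheta(x)$, such that $\vartheta(hx)=\mathsf{t}(h)$, $\iota_{\vartheta(x)}x=x$, $h'(hx)=(h'h)x$. An $(\mathcal{H},\mathcal{G})$-biset is a triple $(X,\vartheta,\varsigma)$ with a left $\mathcal{H}$-set structure (structure map $\vartheta$)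 and a right $\mathcal{G}$-set structure (structure map $\varsigma$) such that $\vartheta(xg)=\vartheta(x)$, $\varsigma(hx)=\varsigma(x)$ and $h(xg)=(hx)g$ whenever defined. Morphisms of bisets are maps commuting with both structure maps and both actions. Two elements $x,x'$ of an $(\mathcal{H},\mathcal{G})$-biset lie in the same orbit iff $x'=hxg$ for some $h\in\mathcal{H}_1$, $g\in\mathcal{G}_1$ with $\mathsf{s}(h)=\vartheta(x)$, $\mathsf{t}(g)=\varsigma(x)$; a set of representatives contains exactly one element of each orbit. Left cosets. For a subgroupoid $\mathcal{L}$ of $\mathcal{H}\times\mathcal{G}$, $\left(\frac{\mathcal{H}\times\mathcal{G}}{\mathcal{L}}\right)^{\mathsf{L}}$ is the set of classes $[(h,g,u,v)]\mathcal{L}$ of tuples with $h\in\mathcal{H}_1$, $g\in\mathcal{G}_1$, $(u,v)=(\mathsf{s}(h),\mathsf{s}(g))\in\mathcal{L}_0$, where $$[(h,g,u,v)]\mathcal{L}=\{(hh_1,gg_1,\mathsf{s}(h_1),\mathsf{s}(g_1))\mid (h_1,g_1)\in\mathcal{L}_1,\ \mathsf{t}(h_1)=\mathsf{s}(h),\ \mathsf{t}(g_1)=\mathsf{s}(g)\}.$$ It is an $(\mathcal{H},\mathcal{G})$-biset with structure maps $[(h,g,u,v)]\mathcal{L}\mapsto\mathsf{t}(h)\in\mathcal{H}_0$ and $[(h,g,u,v)]\mathcal{L}\mapsto\mathsf{t}(g)\in\mathcal{G}_0$ and actions $h_1\cdot[(h,g,u,v)]\mathcal{L}=[(h_1h,g,u,v)]\mathcal{L}$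 and $[(h,g,u,v)]\mathcal{L}\cdot g_1=[(h,g_1^{-1}g,u,v)]\mathcal{L}$. The same definitions apply to subgroupoids of $\mathcal{K}\times\mathcal{H}$ and of $\mathcal{K}\times\mathcal{G}$ (giving a $(\mathcal{K},\mathcal{H})$-biset and a $(\mathcal{K},\mathcal{G})$-biset respectively). Tensor product. If $(V,\vartheta,\varsigma)$ is a $(\mathcal{K},\mathcal{H})$-biset and $(U,\varkappa,\varrho)$ is an $(\mathcal{H},\mathcal{G})$-biset, then $V\otimes_{\mathcal{H}}U$ is the quotient of $\{(x,y)\in V\times U\mid\varsigma(x)=\varkappa(y)\}$ by the equivalence relation $(x,y)\sim(xh,h^{-1}y)$ for $h\in\mathcal{H}_1$ with $\mathsf{t}(h)=\varsigma(x)=\varkappa(y)$. The class of $(x,y)$ is $x\otimes_{\mathcal{H}}y$; it is a $(\mathcal{K},\mathcal{G})$-biset with structure maps $x\otimes_{\mathcal{H}}y\mapsto\vartheta(x)$, $x\otimes_{\mathcal{H}}y\mapsto\varrho(y)$ and actions $k(x\otimes_{\mathcal{H}}y)=kx\otimes_{\mathcal{H}}y$, $(x\otimes_{\mathcal{H}}y)g=x\otimes_{\mathcal{H}}yg$. The biset $X$. Its structure maps are $(w,u,h,v,a)\mapsto(w,u)\in\mathcal{M}_0$ and $(w,u,h,v,a)\mapsto(v,a)\in\mathcal{L}_0$; the left action is $(k,h')\cdot(w,u,h,v,a)=(\mathsf{t}(k),\mathsf{t}(h'),h'h,v,a)$ for $(k,h')\in\mathcal{M}_1$ with source $(w,u)$;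 the right action is $(w,u,h,v,a)\cdot(h'',g)=(w,u,hh'',\mathsf{s}(h''),\mathsf{s}(g))$ for $(h'',g)\in\mathcal{L}_1$ with target $(v,a)$. The subgroupoids in the denominators. For $(w,u,h,v,a)\in X$, $\mathcal{M}^{(w,u)}$ and $\mathcal{L}^{(v,a)}$ are the isotropy groups, and ${}^{(h,\iota_a)}\mathcal{L}^{(v,a)}=(h,\iota_a)\,\mathcal{L}^{(v,a)}\,(h,\iota_a)^{-1}$, a subgroup of the isotropy group of $\mathcal{H}\times\mathcal{G}$ at $(u,a)$. Then $\mathcal{M}^{(w,u)}\ast\left({}^{(h,\iota_a)}\mathcal{L}^{(v,a)}\right)$ is the subgroupoid of $\mathcal{K}\times\mathcal{G}$ with the single object $(w,a)$ and with arrows all $(k,g)\in\mathcal{K}_1\times\mathcal{G}_1$ for which there exists $h'\in\mathcal{H}_1$ with $(k,h')\in\mathcal{M}^{(w,u)}$ and $(h',g)\in{}^{(h,\iota_a)}\mathcal{L}^{(v,a)}$. *)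

theory Defs
  imports "HOL-Library.FuncSet"
begin

text \<open>
  The fields are only meaningful on the carriers \<open>Obj\<close> and \<open>Arr\<close>.  Composition is written in
  functional order: \<open>cmp C g g'\<close> is the arrow $gg'$, relevant only when \<open>src C g = tgt C g'\<close>.
\<close>

record ('o, 'a) gpd =
  Obj :: "'o set"
  Arr :: "'a set"
  src :: "'a \<Rightarrow> 'o"
  tgt :: "'a \<Rightarrow> 'o"
  idn :: "'o \<Rightarrow> 'a"
  cmp :: "'a \<Rightarrow> 'a \<Rightarrow> 'a"

locale small_category =
  fixes C :: "('o, 'a) gpd"
  assumes src_in: "g \<in> Arr C \<Longrightarrow> src C g \<in> Obj C"
    and tgt_in: "g \<in> Arr C \<Longrightarrow> tgt C g \<in> Obj C"
    and idn_in: "x \<in> Obj C \<Longrightarrow> idn C x \<in> Arr C"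
    and src_idn: "x \<in> Obj C \<Longrightarrow> src C (idn C x) = x"
    and tgt_idn: "x \<in> Obj C \<Longrightarrow> tgt C (idn C x) = x"
    and cmp_in: "\<lbrakk>g \<in> Arr C; g' \<in> Arr C; src C g = tgt C g'\<rbrakk> \<Longrightarrow> cmp C g g' \<in> Arr C"
    and src_cmp: "\<lbrakk>g \<in> Arr C; g' \<in> Arr C; src C g = tgt C g'\<rbrakk> \<Longrightarrow> src C (cmp C g g') = src C g'"
    and tgt_cmp: "\<lbrakk>g \<in> Arr C; g' \<in> Arr C; src C g = tgt C g'\<rbrakk> \<Longrightarrow> tgt C (cmp C g g') = tgt C g"
    and cmp_idn: "g \<in> Arr C \<Longrightarrow> cmp C g (idn C (src C g)) = g"
    and idn_cmp: "g \<in> Arr C \<Longrightarrow> cmp C (idn C (tgt C g)) g = g"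
    and cmp_assoc: "\<lbrakk>g \<in> Arr C; g' \<in> Arr C; g'' \<in> Arr C; src C g = tgt C g'; src C g' = tgt C g''\<rbrakk>
      \<Longrightarrow> cmp C (cmp C g g') g'' = cmp C g (cmp C g' g'')"

definition is_inverse :: "('o, 'a) gpd \<Rightarrow> 'a \<Rightarrow> 'a \<Rightarrow> bool" where
  "is_inverse C g g' \<longleftrightarrow> g' \<in> Arr C \<and> src C g' = tgt C g \<and> tgt C g' = src C g \<and>
     cmp C g g' = idn C (tgt C g) \<and> cmp C g' g = idn C (src C g)"

locale groupoid = small_category +
  assumes invertible: "g \<in> Arr C \<Longrightarrow> \<exists>g'. is_inverse C g g'"

definition inv_arr :: "('o, 'a) gpd \<Rightarrow> 'a \<Rightarrow> 'a" where
  "inv_arr C g = (THE g'. is_inverse C g g')"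

definition prod_gpd :: "('o, 'a) gpd \<Rightarrow> ('p, 'b) gpd \<Rightarrow> ('o \<times> 'p, 'a \<times> 'b) gpd" where
  "prod_gpd K H = \<lparr>
     Obj = Obj K \<times> Obj H,
     Arr = Arr K \<times> Arr H,
     src = (\<lambda>(k, h). (src K k, src H h)),
     tgt = (\<lambda>(k, h). (tgt K k, tgt H h)),
     idn = (\<lambda>(x, y). (idn K x, idn H y)),
     cmp = (\<lambda>(k, h) (k', h'). (cmp K k k', cmp H h h'))\<rparr>"

definition subcategory :: "('o, 'a) gpd \<Rightarrow> ('o, 'a) gpd \<Rightarrow> bool" where
  "subcategory D C \<longleftrightarrow> small_category D \<and> Obj D \<subseteq> Obj C \<and> Arr D \<subseteq> Arr C \<and>
     (\<forall>g\<in>Arr D. src D g = src C g \<and> tgt D g = tgt C g) \<and>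
     (\<forall>x\<in>Obj D. idn D x = idn C x) \<and>
     (\<forall>g\<in>Arr D. \<forall>g'\<in>Arr D. src D g = tgt D g' \<longrightarrow> cmp D g g' = cmp C g g')"

definition subgroupoid :: "('o, 'a) gpd \<Rightarrow> ('o, 'a) gpd \<Rightarrow> bool" where
  "subgroupoid D C \<longleftrightarrow> subcategory D C \<and> (\<forall>g\<in>Arr D. inv_arr C g \<in> Arr D)"

definition isotropy :: "('o, 'a) gpd \<Rightarrow> 'o \<Rightarrow> ('o, 'a) gpd" where
  "isotropy C x = C\<lparr>Obj := {x}, Arr := {g \<in> Arr C. src C g = x \<and> tgt C g = x}\<rparr>"

text \<open>The conjugate \<open>p N p\<inverse>\<close> inside \<open>C\<close>, for \<open>N\<close> a subgroup of the isotropy group at \<open>src C p\<close>.\<close>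

definition conjugate :: "('o, 'a) gpd \<Rightarrow> 'a \<Rightarrow> ('o, 'a) gpd \<Rightarrow> ('o, 'a) gpd" where
  "conjugate C p N = C\<lparr>Obj := {tgt C p}, Arr := {cmp C (cmp C p n) (inv_arr C p) | n. n \<in> Arr N}\<rparr>"

text \<open>
  The one-object subgroupoid \<open>A \<^emph> B\<close> of \<open>K \<times> G\<close>, for \<open>A\<close> a subgroup of the isotropy group of
  \<open>K \<times> H\<close> at \<open>(w, u)\<close> and \<open>B\<close> one of the isotropy group of \<open>H \<times> G\<close> at \<open>(u, a)\<close>.
\<close>

definition star_gpd :: "('ko, 'ka) gpd \<Rightarrow> ('ho, 'ha) gpd \<Rightarrow> ('go, 'ga) gpd \<Rightarrow> 'ko \<times> 'go \<Rightarrow>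
    ('ko \<times> 'ho, 'ka \<times> 'ha) gpd \<Rightarrow> ('ho \<times> 'go, 'ha \<times> 'ga) gpd \<Rightarrow> ('ko \<times> 'go, 'ka \<times> 'ga) gpd" where
  "star_gpd K H G x A B = (prod_gpd K G)\<lparr>
     Obj := {x},
     Arr := {(k, g). k \<in> Arr K \<and> g \<in> Arr G \<and> (\<exists>h'\<in>Arr H. (k, h') \<in> Arr A \<and> (h', g) \<in> Arr B)}\<rparr>"

definition right_gset :: "('o, 'a) gpd \<Rightarrow> 'x set \<Rightarrow> ('x \<Rightarrow> 'o) \<Rightarrow> ('x \<Rightarrow> 'a \<Rightarrow> 'x) \<Rightarrow> bool" where
  "right_gset G X \<sigma> act \<longleftrightarrow> \<sigma> \<in> X \<rightarrow> Obj G \<and>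
     (\<forall>x\<in>X. \<forall>g\<in>Arr G. \<sigma> x = tgt G g \<longrightarrow> act x g \<in> X \<and> \<sigma> (act x g) = src G g) \<and>
     (\<forall>x\<in>X. act x (idn G (\<sigma> x)) = x) \<and>
     (\<forall>x\<in>X. \<forall>g\<in>Arr G. \<forall>g'\<in>Arr G. \<sigma> x = tgt G g \<and> src G g = tgt G g' \<longrightarrow>
        act (act x g) g' = act x (cmp G g g'))"

definition left_gset :: "('o, 'a) gpd \<Rightarrow> 'x set \<Rightarrow> ('x \<Rightarrow> 'o) \<Rightarrow> ('a \<Rightarrow> 'x \<Rightarrow> 'x) \<Rightarrow> bool" where
  "left_gset H X \<theta> act \<longleftrightarrow> \<theta> \<in> X \<rightarrow> Obj H \<and>
     (\<forall>x\<in>X. \<forall>h\<in>Arr H. src H h = \<theta> x \<longrightarrow> act h x \<in> X \<and> \<theta> (act h x) = tgt H h) \<and>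
     (\<forall>x\<in>X. act (idn H (\<theta> x)) x = x) \<and>
     (\<forall>x\<in>X. \<forall>h\<in>Arr H. \<forall>h'\<in>Arr H. src H h = \<theta> x \<and> src H h' = tgt H h \<longrightarrow>
        act h' (act h x) = act (cmp H h' h) x)"

record ('x, 'ho, 'ha, 'go, 'ga) bset =
  elts :: "'x set"
  lstr :: "'x \<Rightarrow> 'ho"
  rstr :: "'x \<Rightarrow> 'go"
  lact :: "'ha \<Rightarrow> 'x \<Rightarrow> 'x"
  ract :: "'x \<Rightarrow> 'ga \<Rightarrow> 'x"

definition biset :: "('ho, 'ha) gpd \<Rightarrow> ('go, 'ga) gpd \<Rightarrow> ('x, 'ho, 'ha, 'go, 'ga) bset \<Rightarrow> bool" where
  "biset H G X \<longleftrightarrow>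
     left_gset H (elts X) (lstr X) (lact X) \<and>
     right_gset G (elts X) (rstr X) (ract X) \<and>
     (\<forall>x\<in>elts X. \<forall>g\<in>Arr G. rstr X x = tgt G g \<longrightarrow> lstr X (ract X x g) = lstr X x) \<and>
     (\<forall>x\<in>elts X. \<forall>h\<in>Arr H. src H h = lstr X x \<longrightarrow> rstr X (lact X h x) = rstr X x) \<and>
     (\<forall>x\<in>elts X. \<forall>h\<in>Arr H. \<forall>g\<in>Arr G. src H h = lstr X x \<and> rstr X x = tgt G g \<longrightarrow>
        lact X h (ract X x g) = ract X (lact X h x) g)"

definition biset_hom :: "('ho, 'ha) gpd \<Rightarrow> ('go, 'ga) gpd \<Rightarrow> ('x, 'ho, 'ha, 'go, 'ga) bset \<Rightarrow>
    ('y, 'ho, 'ha, 'go, 'ga) bset \<Rightarrow> ('x \<Rightarrow> 'y) \<Rightarrow> bool" where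
  "biset_hom H G X Y f \<longleftrightarrow> f \<in> elts X \<rightarrow> elts Y \<and>
     (\<forall>x\<in>elts X. lstr Y (f x) = lstr X x \<and> rstr Y (f x) = rstr X x) \<and>
     (\<forall>x\<in>elts X. \<forall>h\<in>Arr H. src H h = lstr X x \<longrightarrow> f (lact X h x) = lact Y h (f x)) \<and>
     (\<forall>x\<in>elts X. \<forall>g\<in>Arr G. rstr X x = tgt G g \<longrightarrow> f (ract X x g) = ract Y (f x) g)"

definition isomorphic_bisets :: "('ho, 'ha) gpd \<Rightarrow> ('go, 'ga) gpd \<Rightarrow>
    ('x, 'ho, 'ha, 'go, 'ga) bset \<Rightarrow> ('y, 'ho, 'ha, 'go, 'ga) bset \<Rightarrow> bool" where
  "isomorphic_bisets H G X Y \<longleftrightarrow> biset H G X \<and> biset H G Y \<and>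
     (\<exists>f f'. biset_hom H G X Y f \<and> biset_hom H G Y X f' \<and>
        (\<forall>x\<in>elts X. f' (f x) = x) \<and> (\<forall>y\<in>elts Y. f (f' y) = y))"

definition orbit :: "('ho, 'ha) gpd \<Rightarrow> ('go, 'ga) gpd \<Rightarrow> ('x, 'ho, 'ha, 'go, 'ga) bset \<Rightarrow> 'x \<Rightarrow> 'x set" where
  "orbit H G X x = {ract X (lact X h x) g | h g.
     h \<in> Arr H \<and> g \<in> Arr G \<and> src H h = lstr X x \<and> tgt G g = rstr X x}"

definition orbit_reps :: "('ho, 'ha) gpd \<Rightarrow> ('go, 'ga) gpd \<Rightarrow> ('x, 'ho, 'ha, 'go, 'ga) bset \<Rightarrow> 'x set \<Rightarrow> bool" where
  "orbit_reps H G X R \<longleftrightarrow> R \<subseteq> elts X \<and> (\<forall>x\<in>elts X. \<exists>!r. r \<in> R \<and> r \<in> orbit H G X x)"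

definition biset_coprod :: "'i set \<Rightarrow> ('i \<Rightarrow> ('x, 'ho, 'ha, 'go, 'ga) bset) \<Rightarrow>
    ('i \<times> 'x, 'ho, 'ha, 'go, 'ga) bset" where
  "biset_coprod I Y = \<lparr>
     elts = (SIGMA i:I. elts (Y i)),
     lstr = (\<lambda>(i, x). lstr (Y i) x),
     rstr = (\<lambda>(i, x). rstr (Y i) x),
     lact = (\<lambda>h (i, x). (i, lact (Y i) h x)),
     ract = (\<lambda>(i, x) g. (i, ract (Y i) x g))\<rparr>"

text \<open>
  The map induced by \<open>f\<close> on the image of \<open>q\<close>, sending \<open>q r\<close> to \<open>f r\<close> for \<open>r \<in> S\<close>.  It is
  meaningful at those values \<open>q r\<close> whose representatives all have the same image under \<open>f\<close>.
\<close>

definition induced :: "'r set \<Rightarrow> ('r \<Rightarrow> 'c) \<Rightarrow> ('r \<Rightarrow> 'd) \<Rightarrow> 'c \<Rightarrow> 'd" where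
  "induced S q f c = (THE d. \<exists>r\<in>S. c = q r \<and> d = f r)"

lemma induced_eq:
  assumes "r \<in> S" and "\<And>r'. r' \<in> S \<Longrightarrow> q r' = q r \<Longrightarrow> f r' = f r"
  shows "induced S q f (q r) = f r"
  unfolding induced_def using assms by (intro the_equality) metis+

definition coset_tuples :: "('ho, 'ha) gpd \<Rightarrow> ('go, 'ga) gpd \<Rightarrow> ('ho \<times> 'go, 'ha \<times> 'ga) gpd \<Rightarrow>
    ('ha \<times> 'ga \<times> 'ho \<times> 'go) set" where
  "coset_tuples H G L = {(h, g, u, v). h \<in> Arr H \<and> g \<in> Arr G \<and>
     (u, v) = (src H h, src G g) \<and> (u, v) \<in> Obj L}"

definition left_coset :: "('ho, 'ha) gpd \<Rightarrow> ('go, 'ga) gpd \<Rightarrow> ('ho \<times> 'go, 'ha \<times> 'ga) gpd \<Rightarrow>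
    'ha \<times> 'ga \<times> 'ho \<times> 'go \<Rightarrow> ('ha \<times> 'ga \<times> 'ho \<times> 'go) set" where
  "left_coset H G L = (\<lambda>(h, g, u, v). {(cmp H h h1, cmp G g g1, src H h1, src G g1) | h1 g1.
     (h1, g1) \<in> Arr L \<and> tgt H h1 = src H h \<and> tgt G g1 = src G g})"

definition left_cosets :: "('ho, 'ha) gpd \<Rightarrow> ('go, 'ga) gpd \<Rightarrow> ('ho \<times> 'go, 'ha \<times> 'ga) gpd \<Rightarrow>
    (('ha \<times> 'ga \<times> 'ho \<times> 'go) set, 'ho, 'ha, 'go, 'ga) bset" where
  "left_cosets H G L = (let S = coset_tuples H G L; q = left_coset H G L in \<lparr>
     elts = q ` S,
     lstr = induced S q (\<lambda>(h, g, u, v). tgt H h),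
     rstr = induced S q (\<lambda>(h, g, u, v). tgt G g),
     lact = (\<lambda>h1. induced S q (\<lambda>(h, g, u, v). q (cmp H h1 h, g, u, v))),
     ract = (\<lambda>c g1. induced S q (\<lambda>(h, g, u, v). q (h, cmp G (inv_arr G g1) g, u, v)) c)\<rparr>)"

definition tensor_pairs :: "('x, 'ko, 'ka, 'ho, 'ha) bset \<Rightarrow> ('y, 'ho, 'ha, 'go, 'ga) bset \<Rightarrow>
    ('x \<times> 'y) set" where
  "tensor_pairs V U = {(x, y). x \<in> elts V \<and> y \<in> elts U \<and> rstr V x = lstr U y}"

definition tensor_rel :: "('ho, 'ha) gpd \<Rightarrow> ('x, 'ko, 'ka, 'ho, 'ha) bset \<Rightarrow>
    ('y, 'ho, 'ha, 'go, 'ga) bset \<Rightarrow> (('x \<times> 'y) \<times> ('x \<times> 'y)) set" where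
  "tensor_rel H V U = {((x, y), (ract V x h, lact U (inv_arr H h) y)) | x y h.
     (x, y) \<in> tensor_pairs V U \<and> h \<in> Arr H \<and> tgt H h = rstr V x}"

definition tensor_elt :: "('ho, 'ha) gpd \<Rightarrow> ('x, 'ko, 'ka, 'ho, 'ha) bset \<Rightarrow>
    ('y, 'ho, 'ha, 'go, 'ga) bset \<Rightarrow> 'x \<times> 'y \<Rightarrow> ('x \<times> 'y) set" where
  "tensor_elt H V U p = tensor_rel H V U `` {p}"

definition tensor :: "('ho, 'ha) gpd \<Rightarrow> ('x, 'ko, 'ka, 'ho, 'ha) bset \<Rightarrow>
    ('y, 'ho, 'ha, 'go, 'ga) bset \<Rightarrow> (('x \<times> 'y) set, 'ko, 'ka, 'go, 'ga) bset" where
  "tensor H V U = (let S = tensor_pairs V U; q = tensor_elt H V U in \<lparr>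
     elts = S // tensor_rel H V U,
     lstr = induced S q (\<lambda>(x, y). lstr V x),
     rstr = induced S q (\<lambda>(x, y). rstr U y),
     lact = (\<lambda>k. induced S q (\<lambda>(x, y). q (lact V k x, y))),
     ract = (\<lambda>c g. induced S q (\<lambda>(x, y). q (x, ract U y g)) c)\<rparr>)"

definition mackey_biset :: "('ko, 'ka) gpd \<Rightarrow> ('ho, 'ha) gpd \<Rightarrow> ('go, 'ga) gpd \<Rightarrow>
    ('ko \<times> 'ho, 'ka \<times> 'ha) gpd \<Rightarrow> ('ho \<times> 'go, 'ha \<times> 'ga) gpd \<Rightarrow>
    ('ko \<times> 'ho \<times> 'ha \<times> 'ho \<times> 'go, 'ko \<times> 'ho, 'ka \<times> 'ha, 'ho \<times> 'go, 'ha \<times> 'ga) bset" where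
  "mackey_biset K H G M L = \<lparr>
     elts = {(w, u, h, v, a). w \<in> Obj K \<and> u \<in> Obj H \<and> h \<in> Arr H \<and> v \<in> Obj H \<and> a \<in> Obj G \<and>
       (w, u) \<in> Obj M \<and> (v, a) \<in> Obj L \<and> u = tgt H h \<and> v = src H h},
     lstr = (\<lambda>(w, u, h, v, a). (w, u)),
     rstr = (\<lambda>(w, u, h, v, a). (v, a)),
     lact = (\<lambda>(k, h') (w, u, h, v, a). (tgt K k, tgt H h', cmp H h' h, v, a)),
     ract = (\<lambda>(w, u, h, v, a) (h'', g). (w, u, cmp H h h'', src H h'', src G g))\<rparr>"

end

theory Submission
  imports Defs
begin

text \<open>
  Every element of the tensor product has the form $[(k, \iota)]\mathcal{M} \otimes [(h, g)]\mathcal{L}$,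
  and $(k, h, g)$, $(k', h', g')$ give the same element iff $k' = km$, $nh' = hn'$, $g' = gl$ for some
  $(m, n) \in \mathcal{M}_1$, $(n', l) \in \mathcal{L}_1$.  Hence the orbit of the element
  $(\mathsf{s}(k), \mathsf{t}(h), h, \mathsf{s}(h), \mathsf{s}(g))$ of $X$ is an invariant, and $h$ can be
  normalised to the representative of its orbit.  For a fixed representative $h$ the remaining freedom
  $(m, l)$ consists of the arrows with $nh = hn'$, that is, of those of
  $\mathcal{M}^{(w,u)} \ast {}^{(h,\iota_a)}\mathcal{L}^{(v,a)}$.  So both sides are the quotient of the
  biset of all $(r, k, g)$, $r$ a representative, by the same kernel.
\<close>

section \<open>Inverses and cancellation in a groupoid\<close>

context groupoid
begin

lemma is_inverse_unique:
  assumes "g \<in> Arr C" "is_inverse C g a" "is_inverse C g b"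
  shows "a = b"
proof -
  have "a = cmp C a (cmp C g b)"
    using assms cmp_idn[of a] by (auto simp: is_inverse_def)
  also have "\<dots> = cmp C (cmp C a g) b"
    using assms by (subst cmp_assoc) (auto simp: is_inverse_def)
  also have "\<dots> = b"
    using assms idn_cmp[of b] by (auto simp: is_inverse_def)
  finally show ?thesis .
qed

lemma inv_arr_eq: "g \<in> Arr C \<Longrightarrow> is_inverse C g a \<Longrightarrow> inv_arr C g = a"
  unfolding inv_arr_def using is_inverse_unique by blast

lemma is_inverse_inv_arr: "g \<in> Arr C \<Longrightarrow> is_inverse C g (inv_arr C g)"
  using invertible inv_arr_eq by metis

lemma inv_arr_simps [simp]:
  assumes "g \<in> Arr C"
  shows "inv_arr C g \<in> Arr C" "src C (inv_arr C g) = tgt C g" "tgt C (inv_arr C g) = src C g"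
    "cmp C g (inv_arr C g) = idn C (tgt C g)" "cmp C (inv_arr C g) g = idn C (src C g)"
  using is_inverse_inv_arr[OF assms] by (auto simp: is_inverse_def)

lemmas category_simps = src_in tgt_in idn_in src_idn tgt_idn cmp_in src_cmp tgt_cmp cmp_assoc

declare category_simps [simp]

lemma cmp_idn' [simp]: "g \<in> Arr C \<Longrightarrow> src C g = x \<Longrightarrow> cmp C g (idn C x) = g"
  using cmp_idn by auto

lemma idn_cmp' [simp]: "g \<in> Arr C \<Longrightarrow> tgt C g = x \<Longrightarrow> cmp C (idn C x) g = g"
  using idn_cmp by auto

lemma inv_arr_cancel [simp]:
  assumes "g \<in> Arr C" "f \<in> Arr C"
  shows "src C g = tgt C f \<Longrightarrow> cmp C (inv_arr C g) (cmp C g f) = f"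
    and "tgt C g = tgt C f \<Longrightarrow> cmp C g (cmp C (inv_arr C g) f) = f"
  using assms by (simp_all flip: cmp_assoc)

lemma inv_arr_inv_arr [simp]: "g \<in> Arr C \<Longrightarrow> inv_arr C (inv_arr C g) = g"
  by (rule inv_arr_eq) (auto simp: is_inverse_def)

lemma inv_arr_idn [simp]: "x \<in> Obj C \<Longrightarrow> inv_arr C (idn C x) = idn C x"
  by (rule inv_arr_eq) (auto simp: is_inverse_def)

lemma inv_arr_cmp [simp]:
  "\<lbrakk>g \<in> Arr C; f \<in> Arr C; src C g = tgt C f\<rbrakk>
    \<Longrightarrow> inv_arr C (cmp C g f) = cmp C (inv_arr C f) (inv_arr C g)"
  by (rule inv_arr_eq) (auto simp: is_inverse_def)

text \<open>The structure maps stay those of \<open>C\<close>, so every equational axiom is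
  inherited and only closure is left to check. This serves the groupoids \<open>star r\<close>,
  which are record updates of a product groupoid.\<close>

lemma subgroupoid_restrict:
  assumes "X \<subseteq> Obj C" "A \<subseteq> Arr C"
    and "\<And>g. g \<in> A \<Longrightarrow> src C g \<in> X \<and> tgt C g \<in> X"
    and "\<And>x. x \<in> X \<Longrightarrow> idn C x \<in> A"
    and "\<And>g g'. \<lbrakk>g \<in> A; g' \<in> A; src C g = tgt C g'\<rbrakk> \<Longrightarrow> cmp C g g' \<in> A"
    and "\<And>g. g \<in> A \<Longrightarrow> inv_arr C g \<in> A"
  shows "subgroupoid (C\<lparr>Obj := X, Arr := A\<rparr>) C"
  unfolding subgroupoid_def subcategory_def small_category_def
  using assms by (auto simp: subset_iff)

end

section \<open>Products of groupoids\<close>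

lemma prod_gpd_simps [simp]:
  "Obj (prod_gpd K H) = Obj K \<times> Obj H" "Arr (prod_gpd K H) = Arr K \<times> Arr H"
  "src (prod_gpd K H) (k, h) = (src K k, src H h)" "tgt (prod_gpd K H) (k, h) = (tgt K k, tgt H h)"
  "idn (prod_gpd K H) (x, y) = (idn K x, idn H y)"
  "cmp (prod_gpd K H) (k, h) (k', h') = (cmp K k k', cmp H h h')"
  by (auto simp: prod_gpd_def)

locale gpd_pair = H: groupoid H + G: groupoid G
  for H :: "('ho, 'ha) gpd" and G :: "('go, 'ga) gpd"
begin

lemma is_inverse_prod:
  "h \<in> Arr H \<Longrightarrow> g \<in> Arr G \<Longrightarrow> is_inverse (prod_gpd H G) (h, g) (inv_arr H h, inv_arr G g)"
  by (auto simp: is_inverse_def)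

sublocale prod: groupoid "prod_gpd H G"
proof
  fix p assume "p \<in> Arr (prod_gpd H G)"
  then show "\<exists>p'. is_inverse (prod_gpd H G) p p'"
    using is_inverse_prod by (cases p) auto
qed auto

lemma inv_arr_prod [simp]:
  "h \<in> Arr H \<Longrightarrow> g \<in> Arr G \<Longrightarrow> inv_arr (prod_gpd H G) (h, g) = (inv_arr H h, inv_arr G g)"
  by (rule prod.inv_arr_eq) (auto intro: is_inverse_prod)

end

section \<open>Bisets, their quotients and a criterion for isomorphism\<close>

lemma biset_hom_comp:
  "biset_hom H G X Y f \<Longrightarrow> biset_hom H G Y Z f' \<Longrightarrow> biset_hom H G X Z (\<lambda>x. f' (f x))"
  unfolding biset_hom_def by (simp add: Pi_iff)

lemma bisetD:
  assumes "biset H G X"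
  shows "\<And>x. x \<in> elts X \<Longrightarrow> lstr X x \<in> Obj H"
    "\<And>x. x \<in> elts X \<Longrightarrow> rstr X x \<in> Obj G"
    "\<And>x h. \<lbrakk>x \<in> elts X; h \<in> Arr H; src H h = lstr X x\<rbrakk> \<Longrightarrow> lact X h x \<in> elts X"
    "\<And>x g. \<lbrakk>x \<in> elts X; g \<in> Arr G; rstr X x = tgt G g\<rbrakk> \<Longrightarrow> ract X x g \<in> elts X"
    "\<And>x h. \<lbrakk>x \<in> elts X; h \<in> Arr H; src H h = lstr X x\<rbrakk> \<Longrightarrow> lstr X (lact X h x) = tgt H h"
    "\<And>x h. \<lbrakk>x \<in> elts X; h \<in> Arr H; src H h = lstr X x\<rbrakk> \<Longrightarrow> rstr X (lact X h x) = rstr X x"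
    "\<And>x g. \<lbrakk>x \<in> elts X; g \<in> Arr G; rstr X x = tgt G g\<rbrakk> \<Longrightarrow> lstr X (ract X x g) = lstr X x"
    "\<And>x g. \<lbrakk>x \<in> elts X; g \<in> Arr G; rstr X x = tgt G g\<rbrakk> \<Longrightarrow> rstr X (ract X x g) = src G g"
    "\<And>x. x \<in> elts X \<Longrightarrow> lact X (idn H (lstr X x)) x = x"
    "\<And>x. x \<in> elts X \<Longrightarrow> ract X x (idn G (rstr X x)) = x"
    "\<And>x h h'. \<lbrakk>x \<in> elts X; h \<in> Arr H; h' \<in> Arr H; src H h = lstr X x; src H h' = tgt H h\<rbrakk>
      \<Longrightarrow> lact X h' (lact X h x) = lact X (cmp H h' h) x"
    "\<And>x g g'. \<lbrakk>x \<in> elts X; g \<in> Arr G; g' \<in> Arr G; rstr X x = tgt G g; src G g = tgt G g'\<rbrakk>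
      \<Longrightarrow> ract X (ract X x g) g' = ract X x (cmp G g g')"
    "\<And>x h g. \<lbrakk>x \<in> elts X; h \<in> Arr H; g \<in> Arr G; src H h = lstr X x; rstr X x = tgt G g\<rbrakk>
      \<Longrightarrow> lact X h (ract X x g) = ract X (lact X h x) g"
  using assms unfolding biset_def left_gset_def right_gset_def by auto

lemma biset_homD:
  assumes "biset_hom H G X Y f"
  shows "\<And>x. x \<in> elts X \<Longrightarrow> f x \<in> elts Y"
    "\<And>x. x \<in> elts X \<Longrightarrow> lstr Y (f x) = lstr X x"
    "\<And>x. x \<in> elts X \<Longrightarrow> rstr Y (f x) = rstr X x"
    "\<And>x h. \<lbrakk>x \<in> elts X; h \<in> Arr H; src H h = lstr X x\<rbrakk> \<Longrightarrow> lact Y h (f x) = f (lact X h x)"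
    "\<And>x g. \<lbrakk>x \<in> elts X; g \<in> Arr G; rstr X x = tgt G g\<rbrakk> \<Longrightarrow> ract Y (f x) g = f (ract X x g)"
  using assms unfolding biset_hom_def by auto

text \<open>The hypotheses say that having equal image under \<open>q\<close> is a congruence for
  the structure maps and both actions, which is what makes each use of \<open>induced\<close> well
  defined. Both \<open>left_cosets\<close> and \<open>tensor\<close> can be written as a record of
  this shape.\<close>

lemma biset_hom_induced:
  assumes X: "biset H G X"
    and str: "\<And>x y. \<lbrakk>x \<in> elts X; y \<in> elts X; q x = q y\<rbrakk> \<Longrightarrow> lstr X x = lstr X y \<and> rstr X x = rstr X y"
    and lact: "\<And>x y h. \<lbrakk>x \<in> elts X; y \<in> elts X; q x = q y; h \<in> Arr H; src H h = lstr X y; lstr X x = lstr X y\<rbrakk>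
      \<Longrightarrow> q (lact X h x) = q (lact X h y)"
    and ract: "\<And>x y g. \<lbrakk>x \<in> elts X; y \<in> elts X; q x = q y; g \<in> Arr G; rstr X y = tgt G g; rstr X x = tgt G g\<rbrakk>
      \<Longrightarrow> q (ract X x g) = q (ract X y g)"
  shows "biset_hom H G X \<lparr>elts = q ` elts X,
    lstr = induced (elts X) q (lstr X), rstr = induced (elts X) q (rstr X),
    lact = (\<lambda>h. induced (elts X) q (\<lambda>x. q (lact X h x))),
    ract = (\<lambda>c g. induced (elts X) q (\<lambda>x. q (ract X x g)) c)\<rparr> q"
proof -
  have "induced (elts X) q (lstr X) (q x) = lstr X x" "induced (elts X) q (rstr X) (q x) = rstr X x"
    if "x \<in> elts X" for x
    using induced_eq[OF that, of q "lstr X"] induced_eq[OF that, of q "rstr X"] that str by blast+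
  moreover have "induced (elts X) q (\<lambda>x. q (lact X h x)) (q x) = q (lact X h x)"
    if "x \<in> elts X" "h \<in> Arr H" "src H h = lstr X x" for x h
  proof (rule induced_eq)
    fix y assume y: "y \<in> elts X" "q y = q x"
    then show "q (lact X h y) = q (lact X h x)"
      using that str[OF y(1) that(1) y(2)] by (intro lact) auto
  qed (rule that)
  moreover have "induced (elts X) q (\<lambda>x. q (ract X x g)) (q x) = q (ract X x g)"
    if "x \<in> elts X" "g \<in> Arr G" "rstr X x = tgt G g" for x g
  proof (rule induced_eq)
    fix y assume y: "y \<in> elts X" "q y = q x"
    then show "q (ract X y g) = q (ract X x g)"
      using that str[OF y(1) that(1) y(2)] by (intro ract) auto
  qed (rule that)
  ultimately show ?thesis
    by (auto simp: biset_hom_def)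
qed

text \<open>Every element of \<open>Y\<close> has the form \<open>f x\<close>, and \<open>f\<close>
  turns each operation of \<open>Y\<close> into one of \<open>X\<close>, so each axiom for
  \<open>Y\<close> is the image of an axiom for \<open>X\<close>. Quotients thereby become bisets
  without any computation with classes.\<close>

lemma biset_surj_image:
  assumes "biset H G X" "biset_hom H G X Y f" "f ` elts X = elts Y" "groupoid H" "groupoid G"
  shows "biset H G Y"
proof -
  interpret H: groupoid H by fact
  interpret G: groupoid G by fact
  show ?thesis
    unfolding biset_def left_gset_def right_gset_def assms(3)[symmetric]
    by (auto simp: bisetD[OF assms(1)] biset_homD(2-)[OF assms(2)])
qed

lemma biset_hom_factor:
  assumes Z: "biset H G Z" and p: "biset_hom H G Z X p" "p ` elts Z = elts X"
    and q: "biset_hom H G Z Y q"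
    and f: "\<And>z. z \<in> elts Z \<Longrightarrow> f (p z) = q z"
  shows "biset_hom H G X Y f"
  unfolding biset_hom_def p(2)[symmetric]
  by (auto simp: f bisetD[OF Z] biset_homD(2-)[OF p(1)] biset_homD[OF q])

text \<open>Two quotients of one biset \<open>Z\<close> by the same kernel are isomorphic. The maps
  choose a preimage in \<open>Z\<close> and project to the other side; by \<open>ker\<close> the
  choice does not matter. That \<open>X\<close> and \<open>Y\<close> are bisets comes along, since
  both are images of \<open>Z\<close>.\<close>

lemma isomorphic_bisetsI:
  assumes Z: "biset H G Z" and HG: "groupoid H" "groupoid G"
    and p: "biset_hom H G Z X p" "p ` elts Z = elts X"
    and q: "biset_hom H G Z Y q" "q ` elts Z = elts Y"
    and ker: "\<And>z z'. z \<in> elts Z \<Longrightarrow> z' \<in> elts Z \<Longrightarrow> p z = p z' \<longleftrightarrow> q z = q z'"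
  shows "isomorphic_bisets H G X Y"
proof -
  define f where "f x = q (inv_into (elts Z) p x)" for x
  define f' where "f' y = p (inv_into (elts Z) q y)" for y
  have f: "f (p z) = q z" if "z \<in> elts Z" for z
    unfolding f_def using that
    by (subst ker[symmetric]) (auto intro: inv_into_into f_inv_into_f)
  have f': "f' (q z) = p z" if "z \<in> elts Z" for z
    unfolding f'_def using that
    by (subst ker) (auto intro: inv_into_into f_inv_into_f)
  have "biset_hom H G X Y f" "biset_hom H G Y X f'"
    using biset_hom_factor[OF Z p q(1) f] biset_hom_factor[OF Z q p(1) f'] by auto
  moreover have "f' (f x) = x" if "x \<in> elts X" for x
    using that f f' by (auto simp flip: p(2))
  moreover have "f (f' y) = y" if "y \<in> elts Y" for y
    using that f f' by (auto simp flip: q(2))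
  ultimately show ?thesis
    unfolding isomorphic_bisets_def
    using biset_surj_image[OF Z p HG] biset_surj_image[OF Z q HG] by blast
qed

section \<open>Subgroupoids of a product and the biset of their left cosets\<close>

locale subgpd_pair = gpd_pair +
  fixes L
  assumes subgpd: "subgroupoid L (prod_gpd H G)"
begin

lemma subgpd_cat: "small_category L"
  using subgpd by (auto simp: subgroupoid_def subcategory_def)

text \<open>\<open>L\<close> is a record with structure maps of its own. On its arrows they agree
  with the componentwise ones, so that later computations take place in \<open>H\<close> and
  \<open>G\<close>.\<close>

lemma subgpd_arr:
  assumes "(h, g) \<in> Arr L"
  shows "h \<in> Arr H" "g \<in> Arr G" "src L (h, g) = (src H h, src G g)" "tgt L (h, g) = (tgt H h, tgt G g)"
    "(src H h, src G g) \<in> Obj L" "(tgt H h, tgt G g) \<in> Obj L" "(inv_arr H h, inv_arr G g) \<in> Arr L"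
proof -
  show *: "h \<in> Arr H" "g \<in> Arr G" "src L (h, g) = (src H h, src G g)" "tgt L (h, g) = (tgt H h, tgt G g)"
    using assms subgpd by (auto simp: subgroupoid_def subcategory_def)
  show "(src H h, src G g) \<in> Obj L" "(tgt H h, tgt G g) \<in> Obj L"
    using small_category.src_in[OF subgpd_cat assms] small_category.tgt_in[OF subgpd_cat assms] *
    by simp_all
  show "(inv_arr H h, inv_arr G g) \<in> Arr L"
    using assms subgpd * inv_arr_prod by (auto simp: subgroupoid_def)
qed

lemma subgpd_idn: "(u, v) \<in> Obj L \<Longrightarrow> (idn H u, idn G v) \<in> Arr L"
  using subgpd small_category.idn_in[OF subgpd_cat, of "(u, v)"]
  by (auto simp: subgroupoid_def subcategory_def)

lemma subgpd_cmp:
  assumes "(h, g) \<in> Arr L" "(h', g') \<in> Arr L" "src H h = tgt H h'" "src G g = tgt G g'"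
  shows "(cmp H h h', cmp G g g') \<in> Arr L"
proof -
  have "cmp L (h, g) (h', g') = (cmp H h h', cmp G g g')"
    using assms subgpd subgpd_arr by (auto simp: subgroupoid_def subcategory_def)
  then show ?thesis
    using small_category.cmp_in[OF subgpd_cat assms(1,2)] subgpd_arr assms by simp
qed

end

text \<open>The biset of representatives: the formulas of \<open>left_cosets\<close> before passing
  to classes. The biset axioms can be checked here on tuples, and \<open>left_coset\<close> is then
  the quotient map.\<close>

definition coset_biset :: "('ho, 'ha) gpd \<Rightarrow> ('go, 'ga) gpd \<Rightarrow> ('ho \<times> 'go, 'ha \<times> 'ga) gpd \<Rightarrow>
    ('ha \<times> 'ga \<times> 'ho \<times> 'go, 'ho, 'ha, 'go, 'ga) bset" where
  "coset_biset H G L = \<lparr>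
     elts = coset_tuples H G L,
     lstr = (\<lambda>(h, g, u, v). tgt H h),
     rstr = (\<lambda>(h, g, u, v). tgt G g),
     lact = (\<lambda>h1 (h, g, u, v). (cmp H h1 h, g, u, v)),
     ract = (\<lambda>(h, g, u, v) g1. (h, cmp G (inv_arr G g1) g, u, v))\<rparr>"

lemma coset_biset_simps [simp]:
  "elts (coset_biset H G L) = coset_tuples H G L"
  "lstr (coset_biset H G L) (h, g, u, v) = tgt H h"
  "rstr (coset_biset H G L) (h, g, u, v) = tgt G g"
  "lact (coset_biset H G L) h1 (h, g, u, v) = (cmp H h1 h, g, u, v)"
  "ract (coset_biset H G L) (h, g, u, v) g1 = (h, cmp G (inv_arr G g1) g, u, v)"
  by (simp_all add: coset_biset_def)

context subgpd_pair
begin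

lemma coset_tuples_iff [simp]:
  "(h, g, u, v) \<in> coset_tuples H G L \<longleftrightarrow>
    h \<in> Arr H \<and> g \<in> Arr G \<and> u = src H h \<and> v = src G g \<and> (u, v) \<in> Obj L"
  by (auto simp: coset_tuples_def)

lemma mem_left_coset_iff:
  "(h', g', u', v') \<in> left_coset H G L (h, g, u, v) \<longleftrightarrow>
    (\<exists>h1 g1. (h1, g1) \<in> Arr L \<and> tgt H h1 = src H h \<and> tgt G g1 = src G g \<and>
      h' = cmp H h h1 \<and> g' = cmp G g g1 \<and> u' = src H h1 \<and> v' = src G g1)"
  by (auto simp: left_coset_def)

lemma biset_coset_biset: "biset H G (coset_biset H G L)"
  unfolding biset_def left_gset_def right_gset_def by auto

text \<open>With the next two lemmas: lying in the coset of a tuple is an equivalence relation on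
  \<open>coset_tuples\<close>, by composites, identities and inverses in \<open>L\<close>.\<close>

lemma left_coset_trans:
  assumes x: "x \<in> coset_tuples H G L" and y: "y \<in> left_coset H G L x"
    and z: "z \<in> left_coset H G L y"
  shows "z \<in> left_coset H G L x"
proof -
  obtain h g u v where xe: "x = (h, g, u, v)" by (cases x) auto
  obtain h1 g1 where 1: "(h1, g1) \<in> Arr L" "tgt H h1 = src H h" "tgt G g1 = src G g"
      "y = (cmp H h h1, cmp G g g1, src H h1, src G g1)"
    using y by (auto simp: xe left_coset_def)
  then obtain h2 g2 where 2: "(h2, g2) \<in> Arr L" "tgt H h2 = src H h1" "tgt G g2 = src G g1"
      "z = (cmp H (cmp H h h1) h2, cmp G (cmp G g g1) g2, src H h2, src G g2)"
    using z subgpd_arr x by (auto simp: left_coset_def xe)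
  have "(cmp H h1 h2, cmp G g1 g2) \<in> Arr L"
    using 1 2 by (intro subgpd_cmp) auto
  then show ?thesis
    using 1 2 x subgpd_arr[of h1 g1] subgpd_arr[of h2 g2]
    by (auto simp: xe mem_left_coset_iff intro!: exI[of _ "cmp H h1 h2"] exI[of _ "cmp G g1 g2"])
qed

lemma left_coset_refl: "x \<in> coset_tuples H G L \<Longrightarrow> x \<in> left_coset H G L x"
proof -
  assume x: "x \<in> coset_tuples H G L"
  obtain h g u v where "x = (h, g, u, v)" by (cases x) auto
  then show ?thesis
    using x subgpd_idn[of u v]
    by (auto simp: mem_left_coset_iff intro!: exI[of _ "idn H u"] exI[of _ "idn G v"])
qed

lemma left_coset_sym:
  assumes x: "x \<in> coset_tuples H G L" and y: "y \<in> left_coset H G L x"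
  shows "x \<in> left_coset H G L y"
proof -
  obtain h g u v where xe: "x = (h, g, u, v)" by (cases x) auto
  obtain h1 g1 where 1: "(h1, g1) \<in> Arr L" "tgt H h1 = src H h" "tgt G g1 = src G g"
      "y = (cmp H h h1, cmp G g g1, src H h1, src G g1)"
    using y by (auto simp: xe left_coset_def)
  then show ?thesis
    using subgpd_arr[OF 1(1)] x
    by (auto simp: xe mem_left_coset_iff intro!: exI[of _ "inv_arr H h1"] exI[of _ "inv_arr G g1"])
qed

lemma left_coset_eq_iff:
  assumes "x \<in> coset_tuples H G L" "y \<in> coset_tuples H G L"
  shows "left_coset H G L x = left_coset H G L y \<longleftrightarrow> y \<in> left_coset H G L x"
  using left_coset_refl[OF assms(2)] left_coset_trans left_coset_sym assms by blast

lemma left_coset_eqE: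
  assumes "(h', g', u', v') \<in> coset_tuples H G L" "(h, g, u, v) \<in> coset_tuples H G L"
    "left_coset H G L (h', g', u', v') = left_coset H G L (h, g, u, v)"
  obtains h1 g1 where "(h1, g1) \<in> Arr L" "h1 \<in> Arr H" "g1 \<in> Arr G" "tgt H h1 = src H h" "tgt G g1 = src G g"
      "h' = cmp H h h1" "g' = cmp G g g1" "u' = src H h1" "v' = src G g1"
proof -
  have "(h', g', u', v') \<in> left_coset H G L (h, g, u, v)"
    using assms left_coset_refl by metis
  then show thesis
    unfolding mem_left_coset_iff using that subgpd_arr(1,2) by blast
qed

lemma left_coset_eqI:
  assumes x: "(h, g, u, v) \<in> coset_tuples H G L"
    and l: "(h1, g1) \<in> Arr L" "tgt H h1 = src H h" "tgt G g1 = src G g"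
  shows "left_coset H G L (cmp H h h1, cmp G g g1, src H h1, src G g1) = left_coset H G L (h, g, u, v)"
proof (rule sym, subst left_coset_eq_iff)
  show "(cmp H h h1, cmp G g g1, src H h1, src G g1) \<in> coset_tuples H G L"
    using x l subgpd_arr[OF l(1)] by simp
  show "(cmp H h h1, cmp G g g1, src H h1, src G g1) \<in> left_coset H G L (h, g, u, v)"
    unfolding mem_left_coset_iff using l by blast
qed (fact x)

text \<open>Arrows of \<open>L\<close> multiply a tuple on the right, while \<open>H\<close> and
  \<open>G\<close> multiply it on the left, the latter through inverses. By associativity the two
  operations commute, so the actions descend to cosets.\<close>

lemma biset_hom_left_coset:
  "biset_hom H G (coset_biset H G L) (left_cosets H G L) (left_coset H G L)"
proof -
  let ?X = "coset_biset H G L" and ?q = "left_coset H G L"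
  \<comment> \<open>All congruence conditions are collected in one statement, because they follow
    from the same decomposition of \<open>x\<close> as \<open>y\<close> multiplied by an arrow
    \<open>(a1, b1)\<close> of \<open>L\<close>.\<close>
  have *: "lstr ?X x = lstr ?X y \<and> rstr ?X x = rstr ?X y \<and>
      (h \<in> Arr H \<longrightarrow> src H h = lstr ?X y \<longrightarrow> ?q (lact ?X h x) = ?q (lact ?X h y)) \<and>
      (g \<in> Arr G \<longrightarrow> rstr ?X y = tgt G g \<longrightarrow> ?q (ract ?X x g) = ?q (ract ?X y g))"
    if xy: "x \<in> elts ?X" "y \<in> elts ?X" "?q x = ?q y" for x y h g
  proof -
    obtain a b u v a' b' u' v' where e: "y = (a, b, u, v)" "x = (a', b', u', v')"
      by (cases x, cases y) auto
    obtain a1 b1 where 1: "(a1, b1) \<in> Arr L" "tgt H a1 = src H a" "tgt G b1 = src G b"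
        "a' = cmp H a a1" "b' = cmp G b b1" "u' = src H a1" "v' = src G b1"
        "a1 \<in> Arr H" "b1 \<in> Arr G"
      by (rule left_coset_eqE[OF _ _ xy(3)[unfolded e]]) (use xy(1,2) in \<open>simp_all only: e coset_biset_simps\<close>)
    have y: "a \<in> Arr H" "b \<in> Arr G" "u = src H a" "v = src G b" "(src H a, src G b) \<in> Obj L"
      using xy(2) by (auto simp: e)
    have "?q (cmp H h a', b', u', v') = ?q (cmp H h a, b, u, v)" if "h \<in> Arr H" "src H h = tgt H a"
      using left_coset_eqI[of "cmp H h a" b u v a1 b1] 1 y that by simp
    moreover have "?q (a', cmp G (inv_arr G g) b', u', v') = ?q (a, cmp G (inv_arr G g) b, u, v)"
      if "g \<in> Arr G" "tgt G b = tgt G g"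
      using left_coset_eqI[of a "cmp G (inv_arr G g) b" u v a1 b1] 1 y that by simp
    ultimately show ?thesis
      using 1 y unfolding e coset_biset_simps by simp
  qed
  have "left_cosets H G L = \<lparr>elts = ?q ` elts ?X,
    lstr = induced (elts ?X) ?q (lstr ?X), rstr = induced (elts ?X) ?q (rstr ?X),
    lact = (\<lambda>h. induced (elts ?X) ?q (\<lambda>x. ?q (lact ?X h x))),
    ract = (\<lambda>c g. induced (elts ?X) ?q (\<lambda>x. ?q (ract ?X x g)) c)\<rparr>"
    by (simp add: left_cosets_def Let_def coset_biset_def case_prod_unfold)
  moreover have "biset_hom H G ?X \<lparr>elts = ?q ` elts ?X,
    lstr = induced (elts ?X) ?q (lstr ?X), rstr = induced (elts ?X) ?q (rstr ?X),
    lact = (\<lambda>h. induced (elts ?X) ?q (\<lambda>x. ?q (lact ?X h x))),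
    ract = (\<lambda>c g. induced (elts ?X) ?q (\<lambda>x. ?q (ract ?X x g)) c)\<rparr> ?q"
    by (rule biset_hom_induced[OF biset_coset_biset]) (use * in blast)+
  ultimately show ?thesis by simp
qed

lemma left_coset_surj: "left_coset H G L ` elts (coset_biset H G L) = elts (left_cosets H G L)"
  by (simp add: left_cosets_def Let_def)

lemma biset_left_cosets: "biset H G (left_cosets H G L)"
  using biset_surj_image[OF biset_coset_biset biset_hom_left_coset left_coset_surj]
  by (simp add: H.groupoid_axioms G.groupoid_axioms)

lemma left_coset_simps [simp]:
  assumes "(h, g, u, v) \<in> coset_tuples H G L"
  shows "left_coset H G L (h, g, u, v) \<in> elts (left_cosets H G L)"
    "lstr (left_cosets H G L) (left_coset H G L (h, g, u, v)) = tgt H h"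
    "rstr (left_cosets H G L) (left_coset H G L (h, g, u, v)) = tgt G g"
    "\<lbrakk>h1 \<in> Arr H; src H h1 = tgt H h\<rbrakk> \<Longrightarrow>
      lact (left_cosets H G L) h1 (left_coset H G L (h, g, u, v)) = left_coset H G L (cmp H h1 h, g, u, v)"
    "\<lbrakk>g1 \<in> Arr G; tgt G g = tgt G g1\<rbrakk> \<Longrightarrow>
      ract (left_cosets H G L) (left_coset H G L (h, g, u, v)) g1 =
        left_coset H G L (h, cmp G (inv_arr G g1) g, u, v)"
  using biset_homD[OF biset_hom_left_coset, of "(h, g, u, v)", unfolded coset_biset_simps, OF assms]
  by auto

end

section \<open>The tensor product as a quotient of the biset of composable pairs\<close>

definition pair_biset :: "('x, 'ko, 'ka, 'ho, 'ha) bset \<Rightarrow> ('y, 'ho, 'ha, 'go, 'ga) bset \<Rightarrow>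
    ('x \<times> 'y, 'ko, 'ka, 'go, 'ga) bset" where
  "pair_biset V U = \<lparr>
     elts = tensor_pairs V U,
     lstr = (\<lambda>(x, y). lstr V x),
     rstr = (\<lambda>(x, y). rstr U y),
     lact = (\<lambda>k (x, y). (lact V k x, y)),
     ract = (\<lambda>(x, y) g. (x, ract U y g))\<rparr>"

lemma pair_biset_simps [simp]:
  "elts (pair_biset V U) = tensor_pairs V U"
  "lstr (pair_biset V U) (x, y) = lstr V x"
  "rstr (pair_biset V U) (x, y) = rstr U y"
  "lact (pair_biset V U) k (x, y) = (lact V k x, y)"
  "ract (pair_biset V U) (x, y) g = (x, ract U y g)"
  by (simp_all add: pair_biset_def)

locale tensor_bisets = K: groupoid K + H: groupoid H + G: groupoid G
  for K :: "('ko, 'ka) gpd" and H :: "('ho, 'ha) gpd" and G :: "('go, 'ga) gpd" +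
  fixes V :: "('x, 'ko, 'ka, 'ho, 'ha) bset" and U :: "('y, 'ho, 'ha, 'go, 'ga) bset"
  assumes V: "biset K H V" and U: "biset H G U"
begin

lemmas V_simps [simp] = bisetD[OF V]
lemmas U_simps [simp] = bisetD[OF U]

lemma tensor_pairs_iff [simp]:
  "(x, y) \<in> tensor_pairs V U \<longleftrightarrow> x \<in> elts V \<and> y \<in> elts U \<and> rstr V x = lstr U y"
  by (auto simp: tensor_pairs_def)

lemma biset_pair_biset: "biset K G (pair_biset V U)"
  unfolding biset_def left_gset_def right_gset_def by auto

lemma tensor_rel_iff:
  "((x, y), (x', y')) \<in> tensor_rel H V U \<longleftrightarrow> (x, y) \<in> tensor_pairs V U \<and>
    (\<exists>h\<in>Arr H. tgt H h = rstr V x \<and> x' = ract V x h \<and> y' = lact U (inv_arr H h) y)"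
  by (auto simp: tensor_rel_def)

text \<open>The relation is that of lying in one orbit of \<open>H\<close> acting on pairs by
  \<open>(x, y)\<close> to \<open>(xh, h^-1 y)\<close>. It is therefore already an equivalence
  relation and no closure has to be taken: the witnesses are an identity, the inverse of
  \<open>h\<close> and the composite of \<open>h\<close> and \<open>h'\<close>.\<close>

lemma equiv_tensor_rel: "equiv (tensor_pairs V U) (tensor_rel H V U)"
proof (rule equivI)
  show "tensor_rel H V U \<subseteq> tensor_pairs V U \<times> tensor_pairs V U"
    by (auto simp: tensor_rel_iff)
  show "refl_on (tensor_pairs V U) (tensor_rel H V U)"
  proof (rule refl_onI)
    fix p assume p: "p \<in> tensor_pairs V U"
    obtain x y where [simp]: "p = (x, y)" by fastforce
    show "(p, p) \<in> tensor_rel H V U"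
      using p by (auto simp: tensor_rel_iff intro!: bexI[of _ "idn H (lstr U y)"])
        (metis V_simps(10))
  qed
  show "sym (tensor_rel H V U)"
  proof (rule symI)
    fix p p' assume p: "(p, p') \<in> tensor_rel H V U"
    obtain x y x' y' where [simp]: "p = (x, y)" "p' = (x', y')" by fastforce
    obtain h where h: "h \<in> Arr H" "tgt H h = rstr V x" "x' = ract V x h" "y' = lact U (inv_arr H h) y"
      "(x, y) \<in> tensor_pairs V U"
      using p by (auto simp: tensor_rel_iff)
    then show "(p', p) \<in> tensor_rel H V U"
      by (auto simp: tensor_rel_iff intro!: bexI[of _ "inv_arr H h"]) (metis V_simps(10))
  qed
  show "trans (tensor_rel H V U)"
  proof (rule transI)
    fix p p' p'' assume p: "(p, p') \<in> tensor_rel H V U" "(p', p'') \<in> tensor_rel H V U"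
    obtain x y x' y' x'' y'' where [simp]: "p = (x, y)" "p' = (x', y')" "p'' = (x'', y'')"
      by (cases p, cases p', cases p'') auto
    obtain h where h: "h \<in> Arr H" "tgt H h = rstr V x" "x' = ract V x h" "y' = lact U (inv_arr H h) y"
      "(x, y) \<in> tensor_pairs V U"
      using p by (auto simp: tensor_rel_iff)
    obtain h' where h': "h' \<in> Arr H" "tgt H h' = rstr V x'" "x'' = ract V x' h'"
      "y'' = lact U (inv_arr H h') y'"
      using p by (auto simp: tensor_rel_iff)
    show "(p, p'') \<in> tensor_rel H V U"
      using h h' by (auto simp: tensor_rel_iff intro!: bexI[of _ "cmp H h h'"])
  qed
qed

lemma tensor_elt_eq_iff:
  assumes "p \<in> tensor_pairs V U" "p' \<in> tensor_pairs V U"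
  shows "tensor_elt H V U p = tensor_elt H V U p' \<longleftrightarrow> (p, p') \<in> tensor_rel H V U"
  using eq_equiv_class_iff[OF equiv_tensor_rel assms] by (simp add: tensor_elt_def)

lemma tensor_elt_surj: "tensor_elt H V U ` elts (pair_biset V U) = elts (tensor H V U)"
  by (auto simp: tensor_def Let_def quotient_def tensor_elt_def)

text \<open>\<open>K\<close> acts on the outer side of \<open>V\<close> and \<open>G\<close> on the
  outer side of \<open>U\<close>, whereas the identification moves an arrow of \<open>H\<close>
  across the inner sides. The biset axioms let these commute, so \<open>tensor_rel\<close> is a
  congruence on \<open>pair_biset V U\<close>.\<close>

lemma biset_hom_tensor_elt: "biset_hom K G (pair_biset V U) (tensor H V U) (tensor_elt H V U)"
proof -
  let ?X = "pair_biset V U" and ?q = "tensor_elt H V U"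
  have *: "lstr ?X p = lstr ?X p' \<and> rstr ?X p = rstr ?X p' \<and>
      (k \<in> Arr K \<longrightarrow> src K k = lstr ?X p' \<longrightarrow> ?q (lact ?X k p) = ?q (lact ?X k p')) \<and>
      (g \<in> Arr G \<longrightarrow> rstr ?X p' = tgt G g \<longrightarrow> ?q (ract ?X p g) = ?q (ract ?X p' g))"
    if p: "p \<in> elts ?X" "p' \<in> elts ?X" "?q p = ?q p'" for p p' k g
  proof -
    obtain x y x' y' where e: "p = (x, y)" "p' = (x', y')"
      by (cases p, cases p') auto
    obtain h where h: "h \<in> Arr H" "tgt H h = rstr V x" "x' = ract V x h" "y' = lact U (inv_arr H h) y"
      using p by (auto simp: tensor_elt_eq_iff tensor_rel_iff e)
    have "?q (lact V k x, y) = ?q (lact V k x', y')" if "k \<in> Arr K" "src K k = lstr V x'"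
      using that p h by (subst tensor_elt_eq_iff) (auto simp: tensor_rel_iff e)
    moreover have "?q (x, ract U y g) = ?q (x', ract U y' g)" if "g \<in> Arr G" "rstr U y' = tgt G g"
      using that p h by (subst tensor_elt_eq_iff) (auto simp: tensor_rel_iff e)
    ultimately show ?thesis
      using p h by (simp add: e)
  qed
  have "tensor H V U = \<lparr>elts = ?q ` elts ?X,
    lstr = induced (elts ?X) ?q (lstr ?X), rstr = induced (elts ?X) ?q (rstr ?X),
    lact = (\<lambda>k. induced (elts ?X) ?q (\<lambda>p. ?q (lact ?X k p))),
    ract = (\<lambda>c g. induced (elts ?X) ?q (\<lambda>p. ?q (ract ?X p g)) c)\<rparr>"
    using tensor_elt_surj by (simp add: tensor_def Let_def pair_biset_def case_prod_unfold)
  moreover have "biset_hom K G ?X \<lparr>elts = ?q ` elts ?X,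
    lstr = induced (elts ?X) ?q (lstr ?X), rstr = induced (elts ?X) ?q (rstr ?X),
    lact = (\<lambda>h. induced (elts ?X) ?q (\<lambda>x. ?q (lact ?X h x))),
    ract = (\<lambda>c g. induced (elts ?X) ?q (\<lambda>x. ?q (ract ?X x g)) c)\<rparr> ?q"
    by (rule biset_hom_induced[OF biset_pair_biset]) (use * in blast)+
  ultimately show ?thesis by simp
qed

end

section \<open>Coproducts of bisets\<close>

lemma biset_coprod_simps [simp]:
  "elts (biset_coprod I Y) = (SIGMA i:I. elts (Y i))"
  "lstr (biset_coprod I Y) (i, x) = lstr (Y i) x"
  "rstr (biset_coprod I Y) (i, x) = rstr (Y i) x"
  "lact (biset_coprod I Y) h (i, x) = (i, lact (Y i) h x)"
  "ract (biset_coprod I Y) (i, x) g = (i, ract (Y i) x g)"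
  by (simp_all add: biset_coprod_def)

lemma biset_biset_coprod:
  assumes "\<And>i. i \<in> I \<Longrightarrow> biset H G (Y i)"
  shows "biset H G (biset_coprod I Y)"
  using assms bisetD[OF assms] unfolding biset_def left_gset_def right_gset_def by auto

lemma biset_hom_coprod:
  assumes "\<And>i. i \<in> I \<Longrightarrow> biset_hom H G (X i) (Y i) (f i)"
  shows "biset_hom H G (biset_coprod I X) (biset_coprod I Y) (\<lambda>(i, x). (i, f i x))"
  using biset_homD[OF assms] unfolding biset_hom_def by auto

section \<open>The subgroupoids in the denominators on the right-hand side\<close>

locale mackey = M: subgpd_pair K H M + L: subgpd_pair H G L
  for K :: "('ko, 'ka) gpd" and H :: "('ho, 'ha) gpd" and G :: "('go, 'ga) gpd" and M L
begin

sublocale tensor_bisets K H G "left_cosets K H M" "left_cosets H G L"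
  by unfold_locales (rule M.biset_left_cosets L.biset_left_cosets)+

abbreviation "X \<equiv> mackey_biset K H G M L"

definition star :: "'ko \<times> 'ho \<times> 'ha \<times> 'ho \<times> 'go \<Rightarrow> ('ko \<times> 'go, 'ka \<times> 'ga) gpd" where
  "star = (\<lambda>(w, u, h, v, a). star_gpd K H G (w, a) (isotropy M (w, u))
     (conjugate (prod_gpd H G) (h, idn G a) (isotropy L (v, a))))"

lemma mem_X_iff [simp]:
  "(w, u, h, v, a) \<in> elts X \<longleftrightarrow>
    h \<in> Arr H \<and> u = tgt H h \<and> v = src H h \<and> w \<in> Obj K \<and> a \<in> Obj G \<and> (w, u) \<in> Obj M \<and> (v, a) \<in> Obj L"
  by (auto simp: mackey_biset_def)

lemma Obj_star [simp]: "Obj (star (w, u, h, v, a)) = {(w, a)}"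
  by (simp add: star_def star_gpd_def)

text \<open>The conjugation condition \<open>n = h n' h^-1\<close> is multiplied by \<open>h\<close>
  to give the commuting square \<open>n h = h n'\<close>. This form is free of inverses and is the
  one produced by comparing elements of the tensor product.\<close>

lemma mem_star_iff:
  assumes "(w, u, h, v, a) \<in> elts X"
  shows "(k, g) \<in> Arr (star (w, u, h, v, a)) \<longleftrightarrow> (\<exists>n n'. (k, n) \<in> Arr M \<and> (n', g) \<in> Arr L \<and>
    src K k = w \<and> tgt K k = w \<and> src H n = u \<and> tgt H n = u \<and>
    src H n' = v \<and> tgt H n' = v \<and> src G g = a \<and> tgt G g = a \<and> cmp H n h = cmp H h n')"
    (is "_ \<longleftrightarrow> ?R")
proof
  assume "(k, g) \<in> Arr (star (w, u, h, v, a))"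
  then obtain n p where n: "(k, n) \<in> Arr M" "src M (k, n) = (w, u)" "tgt M (k, n) = (w, u)"
    and p: "p \<in> Arr L" "src L p = (v, a)" "tgt L p = (v, a)"
      "(n, g) = cmp (prod_gpd H G) (cmp (prod_gpd H G) (h, idn G a) p) (inv_arr (prod_gpd H G) (h, idn G a))"
    by (auto simp: star_def star_gpd_def isotropy_def conjugate_def)
  obtain n' g' where [simp]: "p = (n', g')" by fastforce
  have n': "n' \<in> Arr H" "g' \<in> Arr G" "src H n' = src H h" "tgt H n' = src H h" "src G g' = a" "tgt G g' = a"
    using p L.subgpd_arr[of n' g'] assms by auto
  then have "g' = g" "n = cmp H (cmp H h n') (inv_arr H h)"
    using p(4) assms by simp_all
  moreover from this(2) have "cmp H n h = cmp H h n'"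
    using assms n' by simp
  ultimately show ?R
    using n n' p M.subgpd_arr[of k n] assms by (intro exI[of _ n] exI[of _ n']) auto
next
  assume ?R
  then obtain n n' where 1: "(k, n) \<in> Arr M" "(n', g) \<in> Arr L"
    "src K k = w" "tgt K k = w" "src H n = u" "tgt H n = u"
    "src H n' = v" "tgt H n' = v" "src G g = a" "tgt G g = a" "cmp H n h = cmp H h n'" by blast
  have 2: "k \<in> Arr K" "n \<in> Arr H" "n' \<in> Arr H" "g \<in> Arr G" "src M (k, n) = (w, u)" "tgt M (k, n) = (w, u)"
    "src L (n', g) = (v, a)" "tgt L (n', g) = (v, a)"
    using M.subgpd_arr[of k n] L.subgpd_arr[of n' g] 1 by auto
  \<comment> \<open>Conversely, cancelling \<open>h\<close> on the right of the square exhibits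
    \<open>n\<close> as the conjugate of \<open>n'\<close>.\<close>
  have "n = cmp H (cmp H n h) (inv_arr H h)"
    using 1(1-10) 2 assms by simp
  then have "n = cmp H (cmp H h n') (inv_arr H h)"
    by (simp only: 1(11))
  then have "(n, g) = cmp (prod_gpd H G) (cmp (prod_gpd H G) (h, idn G a) (n', g))
      (inv_arr (prod_gpd H G) (h, idn G a))"
    using 1(1-10) 2 assms by simp
  then have "(n, g) \<in> Arr (conjugate (prod_gpd H G) (h, idn G a) (isotropy L (v, a)))"
    using 1(2) 2(7,8) unfolding conjugate_def isotropy_def by auto
  then show "(k, g) \<in> Arr (star (w, u, h, v, a))"
    using 1(1) 2(1-6) by (auto simp: star_def star_gpd_def isotropy_def)
qed

text \<open>Membership amounts to a square \<open>n h = h n'\<close> over arrows of \<open>M\<close>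
  and \<open>L\<close>. Such squares can be inverted and pasted, and the identities form one; this
  gives the closure properties.\<close>

lemma subgpd_pair_star:
  assumes r: "r \<in> elts X"
  shows "subgpd_pair K G (star r)"
proof -
  obtain w u h v a where e: "r = (w, u, h, v, a)" by (cases r) auto
  have X: "h \<in> Arr H" "u = tgt H h" "v = src H h" "w \<in> Obj K" "a \<in> Obj G" "(w, u) \<in> Obj M" "(v, a) \<in> Obj L"
    using r by (auto simp: e)
  note iff = mem_star_iff[OF r[unfolded e]]
  interpret KG: gpd_pair K G by unfold_locales
  have "subgroupoid ((prod_gpd K G)\<lparr>Obj := {(w, a)}, Arr := Arr (star r)\<rparr>) (prod_gpd K G)"
  proof (rule KG.prod.subgroupoid_restrict)
    show "Arr (star r) \<subseteq> Arr (prod_gpd K G)"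
      by (auto simp: e star_def star_gpd_def)
    fix p assume p: "p \<in> Arr (star r)"
    obtain k g where [simp]: "p = (k, g)" by fastforce
    obtain n n' where n: "(k, n) \<in> Arr M" "(n', g) \<in> Arr L"
      "src K k = w" "tgt K k = w" "src H n = u" "tgt H n = u"
      "src H n' = v" "tgt H n' = v" "src G g = a" "tgt G g = a" "cmp H n h = cmp H h n'"
      using p by (auto simp: e iff)
    note 1 = M.subgpd_arr[OF n(1)] L.subgpd_arr[OF n(2)]
    show "src (prod_gpd K G) p \<in> {(w, a)} \<and> tgt (prod_gpd K G) p \<in> {(w, a)}"
      using n by simp
    \<comment> \<open>Inserting \<open>n' n'^-1\<close> behind \<open>h\<close> creates the factor
      \<open>h n'\<close>. It is replaced by \<open>n h\<close>, whose \<open>n\<close> then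
      cancels.\<close>
    have "cmp H (inv_arr H n) h = cmp H (inv_arr H n) (cmp H (cmp H h n') (inv_arr H n'))"
      using 1 n X by simp
    also have "\<dots> = cmp H h (inv_arr H n')"
      using 1 n(3-10) X by (simp flip: n(11))
    finally have inv: "cmp H (inv_arr H n) h = cmp H h (inv_arr H n')" .
    have "(inv_arr K k, inv_arr G g) \<in> Arr (star r)"
      unfolding e iff
      by (rule exI[of _ "inv_arr H n"], rule exI[of _ "inv_arr H n'"]) (use 1 n(3-10) inv in simp)
    then show "inv_arr (prod_gpd K G) p \<in> Arr (star r)"
      using 1 by simp
    fix p2 assume p2: "p2 \<in> Arr (star r)"
    obtain k2 g2 where [simp]: "p2 = (k2, g2)" by fastforce
    obtain n2 n2' where n2: "(k2, n2) \<in> Arr M" "(n2', g2) \<in> Arr L"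
      "src K k2 = w" "tgt K k2 = w" "src H n2 = u" "tgt H n2 = u"
      "src H n2' = v" "tgt H n2' = v" "src G g2 = a" "tgt G g2 = a" "cmp H n2 h = cmp H h n2'"
      using p2 by (auto simp: e iff)
    note 2 = M.subgpd_arr[OF n2(1)] L.subgpd_arr[OF n2(2)]
    have "cmp H (cmp H n n2) h = cmp H n (cmp H h n2')"
      using 1 2 n n2 X by simp
    also have "\<dots> = cmp H (cmp H n h) n2'"
      using 1 2 n(3-10) n2(3-10) X by simp
    also have "\<dots> = cmp H h (cmp H n' n2')"
      using 1 2 n n2(3-10) X by simp
    finally have cmp: "cmp H (cmp H n n2) h = cmp H h (cmp H n' n2')" .
    have *: "(cmp K k k2, cmp H n n2) \<in> Arr M" "(cmp H n' n2', cmp G g g2) \<in> Arr L"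
      using n n2 by (auto intro: M.subgpd_cmp L.subgpd_cmp)
    have "(cmp K k k2, cmp G g g2) \<in> Arr (star r)"
      unfolding e iff
      by (rule exI[of _ "cmp H n n2"], rule exI[of _ "cmp H n' n2'"])
        (use 1 2 n(3-10) n2(3-10) * cmp in simp)
    then show "cmp (prod_gpd K G) p p2 \<in> Arr (star r)"
      by simp
  next
    have "(idn K w, idn G a) \<in> Arr (star r)"
      unfolding e iff
      by (rule exI[of _ "idn H u"], rule exI[of _ "idn H v"])
        (use X M.subgpd_idn[of w u] L.subgpd_idn[of v a] in simp)
    then show "idn (prod_gpd K G) x \<in> Arr (star r)" if "x \<in> {(w, a)}" for x
      using that by simp
  qed (use X in simp)
  moreover have "(prod_gpd K G)\<lparr>Obj := {(w, a)}, Arr := Arr (star r)\<rparr> = star r"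
    by (simp add: e star_def star_gpd_def)
  ultimately show ?thesis
    by unfold_locales simp
qed

section \<open>A normal form for elements of the tensor product\<close>

definition cosets_of :: "'ka \<times> 'ha \<times> 'ga \<Rightarrow>
    ('ka \<times> 'ha \<times> 'ko \<times> 'ho) set \<times> ('ha \<times> 'ga \<times> 'ho \<times> 'go) set" where
  "cosets_of = (\<lambda>(k, h, g). (left_coset K H M (k, idn H (tgt H h), src K k, tgt H h),
     left_coset H G L (h, g, src H h, src G g)))"

text \<open>The domain of \<open>cosets_of\<close>: the last two conditions make both tuples there
  legitimate coset tuples. The left factor carries an identity as its \<open>H\<close>-entry, since
  any other entry can be moved across the tensor sign into \<open>h\<close>.\<close>

definition triples :: "('ka \<times> 'ha \<times> 'ga) set" where
  "triples = {(k, h, g). k \<in> Arr K \<and> h \<in> Arr H \<and> g \<in> Arr G \<and>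
     (src K k, tgt H h) \<in> Obj M \<and> (src H h, src G g) \<in> Obj L}"

lemma cosets_of_in: "t \<in> triples \<Longrightarrow> cosets_of t \<in> tensor_pairs (left_cosets K H M) (left_cosets H G L)"
  by (auto simp: triples_def cosets_of_def)

text \<open>The tensor relation contributes an arrow \<open>n\<close> of \<open>H\<close>, and the
  two coset equalities contribute arrows \<open>(m, n1)\<close> of \<open>M\<close> and
  \<open>(n', l)\<close> of \<open>L\<close>. The identity entry of the normal form forces
  \<open>n1 = n\<close>, so a single \<open>n\<close> links the two sides.\<close>

lemma tensor_elt_cosets_of_eq_iff:
  assumes t: "(k, h, g) \<in> triples" and t': "(k', h', g') \<in> triples"
  shows "tensor_elt H (left_cosets K H M) (left_cosets H G L) (cosets_of (k, h, g)) =
      tensor_elt H (left_cosets K H M) (left_cosets H G L) (cosets_of (k', h', g')) \<longleftrightarrow>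
    (\<exists>m n n' l. (m, n) \<in> Arr M \<and> (n', l) \<in> Arr L \<and> tgt K m = src K k \<and> tgt H n = tgt H h \<and>
      tgt H n' = src H h \<and> tgt G l = src G g \<and> src H n = tgt H h' \<and>
      k' = cmp K k m \<and> cmp H n h' = cmp H h n' \<and> g' = cmp G g l)" (is "?l \<longleftrightarrow> ?R")
proof -
  have T: "k \<in> Arr K" "h \<in> Arr H" "g \<in> Arr G" "(src K k, tgt H h) \<in> Obj M" "(src H h, src G g) \<in> Obj L"
    "k' \<in> Arr K" "h' \<in> Arr H" "g' \<in> Arr G" "(src K k', tgt H h') \<in> Obj M" "(src H h', src G g') \<in> Obj L"
    using t t' by (auto simp: triples_def)
  \<comment> \<open>The right action on cosets multiplies by the inverse, so acting by
    \<open>n\<close> turns the identity entry of the first factor into \<open>n^-1\<close>; the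
    second factor receives \<open>n^-1 h\<close>.\<close>
  have "?l \<longleftrightarrow> (\<exists>n\<in>Arr H. tgt H n = tgt H h \<and>
     left_coset K H M (k', idn H (tgt H h'), src K k', tgt H h') =
       left_coset K H M (k, inv_arr H n, src K k, tgt H h) \<and>
     left_coset H G L (h', g', src H h', src G g') = left_coset H G L (cmp H (inv_arr H n) h, g, src H h, src G g))"
    unfolding tensor_elt_eq_iff[OF cosets_of_in[OF t] cosets_of_in[OF t']]
    using T by (auto simp: cosets_of_def tensor_rel_iff)
  also have "\<dots> \<longleftrightarrow> (\<exists>n\<in>Arr H. tgt H n = tgt H h \<and>
     (k', idn H (tgt H h'), src K k', tgt H h') \<in> left_coset K H M (k, inv_arr H n, src K k, tgt H h) \<and>
     (h', g', src H h', src G g') \<in> left_coset H G L (cmp H (inv_arr H n) h, g, src H h, src G g))"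
    \<comment> \<open>Each equation is turned round first, so that \<open>left_coset_eq_iff\<close>
      makes the primed tuple the member and the unprimed one the base of the coset.\<close>
    using T by (intro bex_cong conj_cong refl)
      (subst eq_commute, subst M.left_coset_eq_iff L.left_coset_eq_iff, simp_all)+
  also have "\<dots> \<longleftrightarrow> ?R"
  proof
    assume "\<exists>n\<in>Arr H. tgt H n = tgt H h \<and>
     (k', idn H (tgt H h'), src K k', tgt H h') \<in> left_coset K H M (k, inv_arr H n, src K k, tgt H h) \<and>
     (h', g', src H h', src G g') \<in> left_coset H G L (cmp H (inv_arr H n) h, g, src H h, src G g)"
    then obtain n m n1 n' l where 1: "n \<in> Arr H" "tgt H n = tgt H h"
      "(m, n1) \<in> Arr M" "tgt K m = src K k" "tgt H n1 = src H (inv_arr H n)"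
      "k' = cmp K k m" "idn H (tgt H h') = cmp H (inv_arr H n) n1" "tgt H h' = src H n1"
      "(n', l) \<in> Arr L" "tgt H n' = src H (cmp H (inv_arr H n) h)" "tgt G l = src G g"
      "h' = cmp H (cmp H (inv_arr H n) h) n'" "g' = cmp G g l"
      unfolding M.mem_left_coset_iff L.mem_left_coset_iff by blast
    note 2 = M.subgpd_arr[OF 1(3)] L.subgpd_arr[OF 1(9)]
    \<comment> \<open>The \<open>H\<close>-entries of the first factor say that
      \<open>n^-1 n1\<close> is an identity.\<close>
    have "n1 = cmp H n (cmp H (inv_arr H n) n1)"
      using 1(1,5) 2 by simp
    also have "\<dots> = cmp H n (idn H (tgt H h'))"
      by (simp only: 1(7))
    also have "\<dots> = n"
      using 1(1,2,10) 2 T by (simp add: 1(12))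
    finally have n1: "n1 = n" .
    have nh: "cmp H n h' = cmp H h n'"
      using 1(1,2,10) 2 T by (simp add: 1(12))
    show ?R
      by (rule exI[of _ m], rule exI[of _ n], rule exI[of _ n'], rule exI[of _ l])
        (use 1(1-6,8-11,13) 2 T n1 nh in auto)
  next
    assume ?R
    then obtain m n n' l where 1: "(m, n) \<in> Arr M" "(n', l) \<in> Arr L" "tgt K m = src K k" "tgt H n = tgt H h"
      "tgt H n' = src H h" "tgt G l = src G g" "src H n = tgt H h'"
      "k' = cmp K k m" "cmp H n h' = cmp H h n'" "g' = cmp G g l" by blast
    note 2 = M.subgpd_arr[OF 1(1)] L.subgpd_arr[OF 1(2)]
    have h': "h' = cmp H (inv_arr H n) (cmp H h n')"
      using 1(7) 2 T by (simp flip: 1(9))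
    have "src H h' = src H n'"
      using 1(4,5) 2 T by (simp add: h')
    then have "(h', g', src H h', src G g') \<in> left_coset H G L (cmp H (inv_arr H n) h, g, src H h, src G g)"
      unfolding L.mem_left_coset_iff using 1 2 T h' by (intro exI[of _ n'] exI[of _ l]) auto
    moreover have "(k', idn H (tgt H h'), src K k', tgt H h') \<in> left_coset K H M (k, inv_arr H n, src K k, tgt H h)"
      unfolding M.mem_left_coset_iff using 1 2 T by (intro exI[of _ m] exI[of _ n]) auto
    ultimately show "\<exists>n\<in>Arr H. tgt H n = tgt H h \<and>
     (k', idn H (tgt H h'), src K k', tgt H h') \<in> left_coset K H M (k, inv_arr H n, src K k, tgt H h) \<and>
     (h', g', src H h', src G g') \<in> left_coset H G L (cmp H (inv_arr H n) h, g, src H h, src G g)"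
      using 1 2 by blast
  qed
  finally show ?thesis .
qed

lemma tensor_elt_cosets_of_surj:
  "(\<lambda>t. tensor_elt H (left_cosets K H M) (left_cosets H G L) (cosets_of t)) ` triples =
    elts (tensor H (left_cosets K H M) (left_cosets H G L))" (is "?T ` _ = elts ?E")
proof -
  have "e \<in> ?T ` triples" if e: "e \<in> elts ?E" for e
  proof -
    obtain x y where xy: "(x, y) \<in> tensor_pairs (left_cosets K H M) (left_cosets H G L)"
      "e = tensor_elt H (left_cosets K H M) (left_cosets H G L) (x, y)"
      using e unfolding tensor_elt_surj[symmetric] by auto
    then obtain k h1 h2 g where x: "x = left_coset K H M (k, h1, src K k, src H h1)"
        "k \<in> Arr K" "h1 \<in> Arr H" "(src K k, src H h1) \<in> Obj M"
      and y: "y = left_coset H G L (h2, g, src H h2, src G g)"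
        "h2 \<in> Arr H" "g \<in> Arr G" "(src H h2, src G g) \<in> Obj L"
      by (auto simp flip: M.left_coset_surj L.left_coset_surj)
    have h: "tgt H h1 = tgt H h2"
      using xy x y by simp
    \<comment> \<open>Moving \<open>h1\<close> across the tensor sign replaces the entry
      \<open>h1\<close> of \<open>x\<close> by \<open>h1^-1 h1\<close>, an identity, and the entry
      \<open>h2\<close> of \<open>y\<close> by \<open>h1^-1 h2\<close>.\<close>
    have "((x, y), cosets_of (k, cmp H (inv_arr H h1) h2, g)) \<in> tensor_rel H (left_cosets K H M) (left_cosets H G L)"
      using x y h xy by (auto simp: cosets_of_def tensor_rel_iff intro!: bexI[of _ h1])
    moreover have t: "(k, cmp H (inv_arr H h1) h2, g) \<in> triples"
      using x y h by (simp add: triples_def)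
    ultimately have "e = ?T (k, cmp H (inv_arr H h1) h2, g)"
      using xy tensor_elt_eq_iff cosets_of_in by blast
    with t show ?thesis by blast
  qed
  then show ?thesis
    using cosets_of_in by (auto simp flip: tensor_elt_surj)
qed

section \<open>Orbits of the biset \<open>X\<close> and the isomorphism\<close>

lemma mem_orbit_iff:
  assumes "(w, u, h, v, a) \<in> elts X"
  shows "r \<in> orbit M L X (w, u, h, v, a) \<longleftrightarrow> (\<exists>m n n' l. (m, n) \<in> Arr M \<and> (n', l) \<in> Arr L \<and>
     src K m = w \<and> src H n = u \<and> tgt H n' = v \<and> tgt G l = a \<and>
     r = (tgt K m, tgt H n, cmp H (cmp H n h) n', src H n', src G l))"
proof -
  have "r \<in> orbit M L X (w, u, h, v, a) \<longleftrightarrow> (\<exists>m n n' l. (m, n) \<in> Arr M \<and> (n', l) \<in> Arr L \<and>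
     src M (m, n) = (w, u) \<and> tgt L (n', l) = (v, a) \<and>
     r = (tgt K m, tgt H n, cmp H (cmp H n h) n', src H n', src G l))"
    by (auto simp: orbit_def mackey_biset_def)
  also have "\<dots> \<longleftrightarrow> (\<exists>m n n' l. (m, n) \<in> Arr M \<and> (n', l) \<in> Arr L \<and>
     src K m = w \<and> src H n = u \<and> tgt H n' = v \<and> tgt G l = a \<and>
     r = (tgt K m, tgt H n, cmp H (cmp H n h) n', src H n', src G l))"
    by (intro ex_cong1) (auto simp: M.subgpd_arr(3) L.subgpd_arr(4))
  finally show ?thesis .
qed

lemma isomorphic_tensor_left_cosets:
  assumes rep: "orbit_reps M L X rep"
  shows "isomorphic_bisets K G (tensor H (left_cosets K H M) (left_cosets H G L))
    (biset_coprod rep (\<lambda>r. left_cosets K G (star r)))"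
proof -
  let ?V = "left_cosets K H M" and ?U = "left_cosets H G L"
  \<comment> \<open>\<open>?Z\<close> is the common cover required by
    \<open>isomorphic_bisetsI\<close>. It projects to the coproduct by taking cosets in each
    summand, and to the tensor product by \<open>?f\<close> followed by
    \<open>tensor_elt\<close>.\<close>
  let ?Z = "biset_coprod rep (\<lambda>r. coset_biset K G (star r))"
  let ?f = "\<lambda>((w, u, h, v, a), (k, g, _)). cosets_of (k, h, g)"
  have repX: "r \<in> elts X" if "r \<in> rep" for r
    using rep that by (auto simp: orbit_reps_def)
  have star: "subgpd_pair K G (star r)" if "r \<in> rep" for r
    using subgpd_pair_star repX that by blast
  \<comment> \<open>Because \<open>star r\<close> has the single object \<open>(w, a)\<close>, the
    sources of \<open>k\<close> and \<open>g\<close> are fixed by the representative.\<close>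
  have Z: "((w, u, h, v, a), (k, g, w', a')) \<in> elts ?Z \<longleftrightarrow> (w, u, h, v, a) \<in> rep \<and>
      k \<in> Arr K \<and> g \<in> Arr G \<and> w' = src K k \<and> a' = src G g \<and> w = src K k \<and> a = src G g"
    for w u h v a k g w' a'
    using subgpd_pair.coset_tuples_iff[OF star] by auto
  have ZE: "\<exists>w u h v a k g. z = ((w, u, h, v, a), (k, g, w, a)) \<and> (w, u, h, v, a) \<in> rep \<and>
      k \<in> Arr K \<and> g \<in> Arr G \<and> w = src K k \<and> a = src G g \<and> (k, h, g) \<in> triples \<and> u = tgt H h \<and> v = src H h"
    if z: "z \<in> elts ?Z" for z
  proof -
    obtain w u h v a k g w' a' where e: "z = ((w, u, h, v, a), (k, g, w', a'))"
      by (metis surj_pair)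
    show ?thesis
      using z[unfolded e Z] repX[of "(w, u, h, v, a)"] by (auto simp: e triples_def)
  qed
  show ?thesis
  proof (rule isomorphic_bisetsI)
    show "groupoid K" "groupoid G"
      by unfold_locales
    show "biset K G ?Z"
      by (intro biset_biset_coprod subgpd_pair.biset_coset_biset star)
    \<comment> \<open>The actions change only \<open>k\<close> and \<open>g\<close> and leave the
      index \<open>r\<close> alone, by the same formulas on both sides.\<close>
    have "biset_hom K G ?Z (pair_biset ?V ?U) ?f"
      unfolding biset_hom_def
    proof (intro conjI ballI impI Pi_I)
      fix z assume z: "z \<in> elts ?Z"
      obtain w u h v a k g where e: "z = ((w, u, h, v, a), (k, g, w, a))" "(w, u, h, v, a) \<in> rep"
        "k \<in> Arr K" "g \<in> Arr G" "w = src K k" "a = src G g" "(k, h, g) \<in> triples" "u = tgt H h" "v = src H h"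
        using ZE[OF z] by metis
      have t: "h \<in> Arr H" "(src K k, tgt H h) \<in> Obj M" "(src H h, src G g) \<in> Obj L"
        using e(7) by (auto simp: triples_def)
      show "?f z \<in> elts (pair_biset ?V ?U)"
        using cosets_of_in e by simp
      show "lstr (pair_biset ?V ?U) (?f z) = lstr ?Z z" "rstr (pair_biset ?V ?U) (?f z) = rstr ?Z z"
        using e t by (simp_all add: cosets_of_def)
      show "?f (lact ?Z k' z) = lact (pair_biset ?V ?U) k' (?f z)"
        if "k' \<in> Arr K" "src K k' = lstr ?Z z" for k'
        using e t that by (simp add: cosets_of_def)
      show "?f (ract ?Z z g') = ract (pair_biset ?V ?U) (?f z) g'"
        if "g' \<in> Arr G" "rstr ?Z z = tgt G g'" for g'
        using e t that by (simp add: cosets_of_def)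
    qed
    then show "biset_hom K G ?Z (tensor H ?V ?U) (\<lambda>z. tensor_elt H ?V ?U (?f z))"
      using biset_hom_comp biset_hom_tensor_elt by blast
    show "biset_hom K G ?Z (biset_coprod rep (\<lambda>r. left_cosets K G (star r)))
        (\<lambda>(r, x). (r, left_coset K G (star r) x))"
      by (intro biset_hom_coprod subgpd_pair.biset_hom_left_coset star)
    have "(\<lambda>(r, x). (r, left_coset K G (star r) x)) ` (SIGMA r:rep. elts (coset_biset K G (star r))) =
        (SIGMA r:rep. left_coset K G (star r) ` elts (coset_biset K G (star r)))"
      by auto
    then show "(\<lambda>(r, x). (r, left_coset K G (star r) x)) ` elts ?Z =
        elts (biset_coprod rep (\<lambda>r. left_cosets K G (star r)))"
      \<comment> \<open>The congruence rule supplies membership in \<open>rep\<close>, on which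
        \<open>star\<close> and hence surjectivity in each summand depend.\<close>
      by (simp only: biset_coprod_simps subgpd_pair.left_coset_surj[OF star] cong: Sigma_cong)
    show "(\<lambda>z. tensor_elt H ?V ?U (?f z)) ` elts ?Z = elts (tensor H ?V ?U)"
      unfolding tensor_elt_cosets_of_surj[symmetric]
    proof (intro equalityI subsetI; elim imageE; hypsubst)
      fix z assume "z \<in> elts ?Z"
      then show "tensor_elt H ?V ?U (?f z) \<in> (\<lambda>t. tensor_elt H ?V ?U (cosets_of t)) ` triples"
        using ZE by fastforce
    next
      fix t assume t: "t \<in> triples"
      obtain k h g where e: "t = (k, h, g)" by (cases t) auto
      have T: "k \<in> Arr K" "h \<in> Arr H" "g \<in> Arr G" "(src K k, tgt H h) \<in> Obj M" "(src H h, src G g) \<in> Obj L"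
        using t by (auto simp: triples_def e)
      have x: "(src K k, tgt H h, h, src H h, src G g) \<in> elts X"
        using T by simp
      then obtain r where r: "r \<in> rep" "r \<in> orbit M L X (src K k, tgt H h, h, src H h, src G g)"
        using rep unfolding orbit_reps_def by blast
      then obtain m n n' l where 1: "(m, n) \<in> Arr M" "(n', l) \<in> Arr L"
        "src K m = src K k" "src H n = tgt H h" "tgt H n' = src H h" "tgt G l = src G g"
        "r = (tgt K m, tgt H n, cmp H (cmp H n h) n', src H n', src G l)"
        unfolding mem_orbit_iff[OF x] by blast
      note 2 = M.subgpd_arr[OF 1(1)] L.subgpd_arr[OF 1(2)]
      \<comment> \<open>The arrows \<open>(m, n)\<close> and \<open>(n', l)\<close> carry the point
        of \<open>X\<close> given by the triple to its representative \<open>r\<close>. Replacing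
        \<open>h\<close> by \<open>n h n'\<close> is compensated by \<open>m^-1\<close> in
        \<open>k\<close> and \<open>l\<close> in \<open>g\<close>, so the element of the tensor
        product is unchanged.\<close>
      let ?k = "cmp K k (inv_arr K m)" and ?g = "cmp G g l" and ?h = "cmp H (cmp H n h) n'"
      let ?z = "(r, (?k, ?g, tgt K m, src G l))"
      have z: "?z \<in> elts ?Z"
        unfolding 1(7) Z using r(1)[unfolded 1(7)] 1(3-6) 2 T by simp
      have t': "(?k, ?h, ?g) \<in> triples"
        using 1(1-6) 2 T by (simp add: triples_def)
      have "tensor_elt H ?V ?U (cosets_of (k, h, g)) = tensor_elt H ?V ?U (cosets_of (?k, ?h, ?g))"
        unfolding tensor_elt_cosets_of_eq_iff[OF t[unfolded e] t']
        by (rule exI[of _ "inv_arr K m"], rule exI[of _ "inv_arr H n"], rule exI[of _ n'], rule exI[of _ l])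
          (use 1(1-6) 2 T in simp)
      then show "tensor_elt H ?V ?U (cosets_of t) \<in> (\<lambda>z. tensor_elt H ?V ?U (?f z)) ` elts ?Z"
        using z by (intro image_eqI[of _ _ ?z]) (simp_all only: e 1(7) prod.case)
    qed
    fix z z' assume zz: "z \<in> elts ?Z" "z' \<in> elts ?Z"
    obtain w u h v a k g where e: "z = ((w, u, h, v, a), (k, g, w, a))" "(w, u, h, v, a) \<in> rep"
      "k \<in> Arr K" "g \<in> Arr G" "w = src K k" "a = src G g" "(k, h, g) \<in> triples" "u = tgt H h" "v = src H h"
      using ZE[OF zz(1)] by metis
    obtain w' u' h' v' a' k' g' where e': "z' = ((w', u', h', v', a'), (k', g', w', a'))" "(w', u', h', v', a') \<in> rep"
      "k' \<in> Arr K" "g' \<in> Arr G" "w' = src K k'" "a' = src G g'" "(k', h', g') \<in> triples" "u' = tgt H h'" "v' = src H h'"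
      using ZE[OF zz(2)] by metis
    have T: "h \<in> Arr H" "(src K k, tgt H h) \<in> Obj M" "(src H h, src G g) \<in> Obj L"
      "h' \<in> Arr H" "(src K k', tgt H h') \<in> Obj M" "(src H h', src G g') \<in> Obj L"
      using e(7) e'(7) by (auto simp: triples_def)
    let ?r = "(w, u, h, v, a)" and ?r' = "(w', u', h', v', a')"
    have x: "?r \<in> elts X" "?r' \<in> elts X"
      using e e' repX by blast+
    interpret S: subgpd_pair K G "star ?r"
      using star e by blast
    have "tensor_elt H ?V ?U (?f z) = tensor_elt H ?V ?U (?f z') \<longleftrightarrow>
      (\<exists>m n n' l. (m, n) \<in> Arr M \<and> (n', l) \<in> Arr L \<and> tgt K m = src K k \<and> tgt H n = tgt H h \<and>
      tgt H n' = src H h \<and> tgt G l = src G g \<and> src H n = tgt H h' \<and>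
      k' = cmp K k m \<and> cmp H n h' = cmp H h n' \<and> g' = cmp G g l)" (is "_ \<longleftrightarrow> ?R")
      using tensor_elt_cosets_of_eq_iff[OF e(7) e'(7)] by (simp add: e(1) e'(1))
    also have "?R \<longleftrightarrow> ?r = ?r' \<and> (k', g', w, a) \<in> left_coset K G (star ?r) (k, g, w, a)"
    proof
      assume ?R
      then obtain m n n' l where 1: "(m, n) \<in> Arr M" "(n', l) \<in> Arr L"
        "tgt K m = src K k" "tgt H n = tgt H h"
        "tgt H n' = src H h" "tgt G l = src G g" "src H n = tgt H h'"
        "k' = cmp K k m" "cmp H n h' = cmp H h n'" "g' = cmp G g l"
        by blast
      note 2 = M.subgpd_arr[OF 1(1)] L.subgpd_arr[OF 1(2)]
      have s: "src H h' = src H n'" "src K k' = src K m" "src G g' = src G l"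
      proof -
        have "src H (cmp H n h') = src H (cmp H h n')" by (simp only: 1(9))
        then show "src H h' = src H n'" using 1(5,7) 2 T by simp
      qed (use 1(3,6,8,10) e(3,4) 2 in simp_all)
      \<comment> \<open>The square solved for \<open>h\<close>: it is obtained from
        \<open>h'\<close> by multiplying with \<open>n\<close> on the left and \<open>n'^-1\<close>
        on the right, which is an orbit move in \<open>X\<close>.\<close>
      have "h = cmp H (cmp H h n') (inv_arr H n')"
        using 1(5) 2 T by simp
      also have "\<dots> = cmp H (cmp H n h') (inv_arr H n')"
        by (simp only: 1(9))
      finally have h: "cmp H (cmp H n h') (inv_arr H n') = h" ..
      have orb: "?r \<in> orbit M L X ?r'"
        unfolding mem_orbit_iff[OF x(2)]
        by (rule exI[of _ m], rule exI[of _ n], rule exI[of _ "inv_arr H n'"], rule exI[of _ "inv_arr G l"])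
          (use 1(1-7) 2 s h e(5,6,8,9) e'(5,6,8,9) in simp)
      have idn: "(idn K w', idn H u') \<in> Arr M" "(idn H v', idn G a') \<in> Arr L"
        using M.subgpd_idn[OF T(5)] L.subgpd_idn[OF T(6)] by (simp_all only: e'(5,6,8,9))
      have obj: "w' \<in> Obj K" "u' \<in> Obj H" "v' \<in> Obj H" "a' \<in> Obj G" "h' \<in> Arr H"
        "tgt H h' = u'" "src H h' = v'"
        using T(4) e'(3,4) by (simp_all only: e'(5,6,8,9) M.H.src_in M.G.src_in L.G.src_in M.G.tgt_in)
      \<comment> \<open>\<open>orbit_reps\<close> allows one representative in the orbit of a given
        point, so \<open>?r'\<close> must also be seen to lie in its own orbit, by identities,
        before it can be equated with \<open>?r\<close>.\<close>
      have "?r' \<in> orbit M L X ?r'"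
        unfolding mem_orbit_iff[OF x(2)]
        by (rule exI[of _ "idn K w'"], rule exI[of _ "idn H u'"], rule exI[of _ "idn H v'"], rule exI[of _ "idn G a'"])
          (simp add: idn obj)
      with orb have r: "?r = ?r'"
        using rep x(2) e(2) e'(2) unfolding orbit_reps_def by blast
      \<comment> \<open>Once the representatives agree, \<open>m\<close>, \<open>n\<close>,
        \<open>n'\<close> and \<open>l\<close> become loops and the square reads
        \<open>n h = h n'\<close>, which is the membership condition for
        \<open>star ?r\<close>.\<close>
      have eq: "src K m = w" "src H n = u" "src H n' = v" "src G l = a" "cmp H n h = cmp H h n'"
        using r s 1(7,9) e'(5,6,8,9) by (simp_all only: prod.inject)
      have "(m, l) \<in> Arr (star ?r)"
        unfolding mem_star_iff[OF x(1)]
        by (rule exI[of _ n], rule exI[of _ n'])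
          (simp only: 1(1-6) eq e(5,6,8,9)[symmetric] conj_assoc simp_thms)
      then have "(k', g', w, a) \<in> left_coset K G (star ?r) (k, g, w, a)"
        unfolding S.mem_left_coset_iff
        by (intro exI[of _ m] exI[of _ l]) (simp add: 1(3,6,8,10) eq)
      with r show "?r = ?r' \<and> (k', g', w, a) \<in> left_coset K G (star ?r) (k, g, w, a)" ..
    next
      assume *: "?r = ?r' \<and> (k', g', w, a) \<in> left_coset K G (star ?r) (k, g, w, a)"
      then obtain m l where 1: "(m, l) \<in> Arr (star ?r)" "tgt K m = src K k" "tgt G l = src G g"
        "k' = cmp K k m" "g' = cmp G g l"
        unfolding S.mem_left_coset_iff by blast
      \<comment> \<open>The converse needs no orbit argument: membership in \<open>star ?r\<close>
        already supplies the two middle arrows and their square.\<close>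
      from 1(1) obtain n n' where 2: "(m, n) \<in> Arr M" "(n', l) \<in> Arr L"
        "src H n = u" "tgt H n = u" "tgt H n' = v" "cmp H n h = cmp H h n'"
        unfolding mem_star_iff[OF x(1)] by blast
      have h': "h' = h" using * by simp
      show ?R
        unfolding h'
        by (intro exI[of _ m], rule exI[of _ n], rule exI[of _ n'], rule exI[of _ l])
          (simp add: 1(2-5) 2 e(8,9)[symmetric])
    qed
    also have "\<dots> \<longleftrightarrow> (case z of (r, x) \<Rightarrow> (r, left_coset K G (star r) x)) =
        (case z' of (r, x) \<Rightarrow> (r, left_coset K G (star r) x))"
    \<comment> \<open>Different representatives give different summands, making both sides false.
      For equal ones \<open>w' = w\<close> and \<open>a' = a\<close>, and equality of cosets is
      membership.\<close>
    proof (cases "?r = ?r'")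
      case True
      have "(k, g, w, a) \<in> coset_tuples K G (star ?r)" "(k', g', w', a') \<in> coset_tuples K G (star ?r')"
        using zz unfolding e(1) e'(1) by (simp_all only: biset_coprod_simps coset_biset_simps mem_Sigma_iff)
      then have "left_coset K G (star ?r) (k, g, w, a) = left_coset K G (star ?r) (k', g', w, a) \<longleftrightarrow>
          (k', g', w, a) \<in> left_coset K G (star ?r) (k, g, w, a)"
        using True by (intro S.left_coset_eq_iff) (simp_all only: prod.inject)
      then show ?thesis
        using True by (simp only: e(1) e'(1) prod.case prod.inject)
    next
      case False
      then show ?thesis
        by (simp only: e(1) e'(1) prod.case prod.inject) blast
    qed
    finally show "tensor_elt H ?V ?U (?f z) = tensor_elt H ?V ?U (?f z') \<longleftrightarrow>
      (case z of (r, x) \<Rightarrow> (r, left_coset K G (star r) x)) =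
        (case z' of (r, x) \<Rightarrow> (r, left_coset K G (star r) x))" .
  qed
qed

end

theorem theoremA:
  fixes K :: "('ko, 'ka) gpd" and H :: "('ho, 'ha) gpd" and G :: "('go, 'ga) gpd"
    and M :: "('ko \<times> 'ho, 'ka \<times> 'ha) gpd" and L :: "('ho \<times> 'go, 'ha \<times> 'ga) gpd"
    and rep :: "('ko \<times> 'ho \<times> 'ha \<times> 'ho \<times> 'go) set"
  assumes "groupoid K" and "groupoid H" and "groupoid G"
    and "subgroupoid M (prod_gpd K H)" and "Obj M = Obj K \<times> Obj H"
    and "subgroupoid L (prod_gpd H G)" and "Obj L = Obj H \<times> Obj G"
    and "orbit_reps M L (mackey_biset K H G M L) rep"
  shows "isomorphic_bisets K G
    (tensor H (left_cosets K H M) (left_cosets H G L))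
    (biset_coprod rep (\<lambda>(w, u, h, v, a). left_cosets K G
      (star_gpd K H G (w, a)
        (isotropy M (w, u))
        (conjugate (prod_gpd H G) (h, idn G a) (isotropy L (v, a))))))"
proof -
  interpret mackey K H G M L
    by (intro mackey.intro subgpd_pair.intro gpd_pair.intro subgpd_pair_axioms.intro assms)
  have "(\<lambda>r. left_cosets K G (star r)) = (\<lambda>(w, u, h, v, a). left_cosets K G
      (star_gpd K H G (w, a) (isotropy M (w, u))
        (conjugate (prod_gpd H G) (h, idn G a) (isotropy L (v, a)))))"
    by (auto simp: star_def)
  then show ?thesis
    using isomorphic_tensor_left_cosets[OF assms(8)] by simp
qed

end
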